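(* Consider the multi-period economic dispatch problem with general mobile storage (MPED-S) defined in the context, and assume LICQ: given any relocation pattern, the constraints binding at the solution of MPED-S are linearly independent. Let the relocation pattern $\mathfrak E$ and capacities $\overline{\mathbf s}$ be given, fix a storage unit $k$, and let $\mathcal T^{\mathrm e}=\{t^{\mathrm e}_1<\dots<t^{\mathrm e}_{T^{\mathrm e}}\}$ and $\mathcal T^{\mathrm p}=\{t^{\mathrm p}_s\}$ be the two disjoint sets into which, under LICQ, the binding storage constraints of unit $k$ partition $[T]$: the times when energy-capacity constraints are binding and the times when power-capacity constraints are binding, respectively. For $t^{\mathrm p}\in\mathcal T^{\mathrm p}$ let $\sigma(t^{\mathrm p})=\inf\{\tau\in\mathcal T^{\mathrm e}:\tau>t^{\mathrm p}\}$ be the next energy-capacity-constrained time. Then the marginal value of mobile storage $k$ with relocation $\mathfrak E$, $\mathsf{MV}^{\mathrm{ms}}_k(\mathfrak E,\overline{\mathbf s}):=-\partial J^{\mathrm{ED}}(\mathfrak E,\overline{\mathbf s})/\partial\overline s_k$, is $$\mathsf{MV}^{\mathrm{ms}}_k(\mathfrak E,\overline{\mathbf s})=\mathbf 1^\top\boldsymbol\mu_k+\overline u_k'(\overline s_k)\,(\boldsymbol\Delta^{\mathrm S}_k)^\top(\boldsymbol\omega_k+\boldsymbol\phi_k),$$ where for each $t^{\mathrm e}_r\in\mathcal T^{\mathrm e}$, $$\mu_k(t^{\mathrm e}_r)=\Big(\lambda_{i_k(t^{\mathrm e}_{r+1})}(t^{\mathrm e}_{r+1})-\lambda_{i_k(t^{\mathrm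 e}_r)}(t^{\mathrm e}_r)\Big)_+,\qquad \omega_k(t^{\mathrm e}_r)+\phi_k(t^{\mathrm e}_r)=0,$$ for each $t^{\mathrm p}_s\in\mathcal T^{\mathrm p}$, $$\mu_k(t^{\mathrm p}_s)=0,\qquad \omega_k(t^{\mathrm p}_s)+\phi_k(t^{\mathrm p}_s)=\Big|\lambda_{i_k(\sigma(t^{\mathrm p}_s))}(\sigma(t^{\mathrm p}_s))-\lambda_{i_k(t^{\mathrm p}_s)}(t^{\mathrm p}_s)\Big|,$$ and $t^{\mathrm e}_{T^{\mathrm e}+1}:=T+1$, $\boldsymbol\lambda(T+1):=\mathbf 0$.
   Context: Notation: $[n]=\{1,\dots,n\}$; $\mathbf 1$ is an all-one vector; $\mathbf e_i$ is the $i$-th elementary vector; $(x)_+=\max\{x,0\}$. Data: a power network with $n$ buses and $m$ lines over periods $t\in[T]$, each of length $\Delta$; inelastic loads $\mathbf d(t)\in\mathbb R^n$; generation $\mathbf g(t)\in\mathbb R^n$ with cost $C(\mathbf g(t))=\sum_i C_i(g_i(t))$, each $C_i$ a strictly convex quadratic; shift-factor matrix $H\in\mathbb R^{2m\times n}$; line capacities $\overline{\mathbf f}\in\mathbb R^{2m}$. There are $K$ storage units; unit $k$ is at bus $i_k(t)\in[n]$ at the beginning of period $t$ and is moved to bus $i_k(t+1)$ during period $t$; $E(t)=[\mathbf e_{i_1(t)},\dots,\mathbf e_{i_K(t)}]$; the relocation pattern $\mathfrak E$ is the collection of these locations. $D\in\mathbb R^{n\times n}$ is the matrix of travel times between buses,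 with $D_{ij}\le\Delta$; the time available for charging/discharging is $\Delta^{\mathrm S}_k(t)=\Delta-D_{i_k(t),i_k(t+1)}\in[0,\Delta]$ and $\boldsymbol\Delta^{\mathrm S}_k=(\Delta^{\mathrm S}_k(t))_{t\in[T]}$. Unit $k$ has energy capacity $\overline s_k$ and power rating $\overline u_k=\overline u_k(\overline s_k)$, a continuously differentiable function of $\overline s_k$. $u_k(t)$ is the energy charged ($>0$) or discharged ($<0$) in period $t$; $\mathbf u(t)=(u_1(t),\dots,u_K(t))^\top$, $\mathbf u_k=(u_k(1),\dots,u_k(T))^\top$. Each unit starts empty. $L\in\mathbb R^{T\times T}$ has $L_{ij}=1$ if $i\ge j$ and $0$ otherwise. MPED-S: minimize $\sum_{t=1}^T C(\mathbf g(t))$ over $\mathbf g,\mathbf u$ subject to, with $\mathbf p(t)=\mathbf g(t)-\mathbf d(t)-E(t)\mathbf u(t)$, (i) $\mathbf 1^\top\mathbf p(t)=0$, $t\in[T]$; (ii) $H\mathbf p(t)\le\overline{\mathbf f}$, $t\in[T]$; (iii) $\mathbf 0\le L\mathbf u_k\le\overline s_k\mathbf 1$, $k\in[K]$ (energy capacity); (iv) $-\overline u_k(\overline s_k)\boldsymbol\Delta^{\mathrm S}_k\le\mathbf u_k\le\overline u_k(\overline s_k)\boldsymbol\Delta^{\mathrm S}_k$, $k\in[K]$ (power capacity). Its optimal value is $J^{\mathrm{ED}}(\mathfrak E,\overline{\mathbf s})$. Optimal dual variables: $\gamma(t)\in\mathbb R$ for (i), $\boldsymbol\beta(t)\ge\mathbf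 0$ for (ii), $\boldsymbol\nu_k,\boldsymbol\mu_k\ge\mathbf 0$ for the lower/upper bounds in (iii), $\boldsymbol\omega_k,\boldsymbol\phi_k\ge\mathbf 0$ for the lower/upper bounds in (iv); Lagrangian sign convention: $\sum_t[C(\mathbf g(t))-\gamma(t)\mathbf 1^\top\mathbf p(t)+\boldsymbol\beta(t)^\top(H\mathbf p(t)-\overline{\mathbf f})]+\sum_k[\boldsymbol\mu_k^\top(L\mathbf u_k-\overline s_k\mathbf 1)-\boldsymbol\nu_k^\top L\mathbf u_k+\boldsymbol\phi_k^\top(\mathbf u_k-\overline u_k\boldsymbol\Delta^{\mathrm S}_k)-\boldsymbol\omega_k^\top(\mathbf u_k+\overline u_k\boldsymbol\Delta^{\mathrm S}_k)]$. Locational marginal prices (LMPs): $\boldsymbol\lambda(t)=\gamma(t)\mathbf 1-H^\top\boldsymbol\beta(t)$, $t\in[T]$. Binding constraints of unit $k$: they are read off from the price arbitrage problem of unit $k$, namely maximize $-\sum_{t=1}^T\lambda_{i_k(t)}(t)u_k(t)$ over $\mathbf u_k$ subject to (iii) and (iv) for that $k$. It is supposed that this problem has a unique solution, in which case that solution coincides with the operation of unit $k$ in a solution of MPED-S, so both lead to the same collection of binding constraints for unit $k$. That these binding constraints partition $[T]$ into the disjoint sets $\mathcal T^{\mathrm e}$ and $\mathcal T^{\mathrm p}$ is asserted as a consequence of LICQ; it is not a separate hypothesis. Remark: $\sigma$ is defined for all $t^{\mathrm p}\in\mathcal T^{\mathrm p}$ when $T\in\mathcal T^{\mathrm e}$,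 which is the case when the LMPs are nonnegative, since then the optimal state of charge in the terminal period is empty.
   Formalization: LICQ does not force the binding storage constraints of unit k to partition [T], so the per-period formulas for the multipliers are stated under the added condition that every period lies in T^e or T^p; disjointness is then proved, and the marginal-value formula needs no such condition. *)

theory Defs
  imports "HOL-Analysis.Analysis"
begin

(* Periods are the naturals 1..periods N; functions of time are only ever inspected there
   (and a relocation pattern also at periods N + 1). The line constraints are indexed by the
   sum type 'm + 'm, i.e. by 2 * CARD('m) rows. *)

record ('n, 'm, 'k) network =
  periods :: nat
  period_length :: real
  load :: "nat \<Rightarrow> real ^ 'n"
  gen_cost :: "'n \<Rightarrow> real \<Rightarrow> real"
  shift_factor :: "real ^ 'n ^ ('m + 'm)"
  line_capacity :: "real ^ ('m + 'm)"
  travel_time :: "real ^ 'n ^ 'n"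
  power_rating :: "'k \<Rightarrow> real \<Rightarrow> real"

definition strictly_convex_quadratic :: "(real \<Rightarrow> real) \<Rightarrow> bool" where
  "strictly_convex_quadratic f \<longleftrightarrow> (\<exists>a b c. a > 0 \<and> (\<forall>x. f x = a * x\<^sup>2 + b * x + c))"

definition network_data :: "('n::finite, 'm::finite, 'k::finite) network \<Rightarrow> bool" where
  "network_data N \<longleftrightarrow>
     periods N \<ge> 1 \<and> period_length N > 0 \<and>
     (\<forall>i. strictly_convex_quadratic (gen_cost N i)) \<and>
     (\<forall>i j. 0 \<le> travel_time N $ i $ j \<and> travel_time N $ i $ j \<le> period_length N) \<and>
     (\<forall>k. power_rating N k C1_differentiable_on {0<..})"

type_synonym ('n, 'k) relocation = "'k \<Rightarrow> nat \<Rightarrow> 'n"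

definition storage_time ::
  "('n::finite, 'm::finite, 'k::finite) network \<Rightarrow> ('n, 'k) relocation \<Rightarrow> 'k \<Rightarrow> nat \<Rightarrow> real" where
  "storage_time N loc k t = period_length N - travel_time N $ loc k t $ loc k (t + 1)"

(* The power limit of unit k, as an energy per period. *)
definition power_limit ::
  "('n::finite, 'm::finite, 'k::finite) network \<Rightarrow> ('n, 'k) relocation \<Rightarrow> ('k \<Rightarrow> real) \<Rightarrow> 'k \<Rightarrow> nat \<Rightarrow> real" where
  "power_limit N loc s k t = power_rating N k (s k) * storage_time N loc k t"

(* Component t of L u for the lower triangular all-one matrix L. *)
definition soc :: "(nat \<Rightarrow> real) \<Rightarrow> nat \<Rightarrow> real" where
  "soc uk t = (\<Sum>\<tau>=1..t. uk \<tau>)"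

(* The injections p(t) = g(t) - d(t) - E(t) u(t). *)
definition injection ::
  "('n::finite, 'm::finite, 'k::finite) network \<Rightarrow> ('n, 'k) relocation \<Rightarrow>
   (nat \<Rightarrow> real ^ 'n) \<Rightarrow> ('k \<Rightarrow> nat \<Rightarrow> real) \<Rightarrow> nat \<Rightarrow> real ^ 'n" where
  "injection N loc g u t = g t - load N t - (\<Sum>k\<in>UNIV. u k t *\<^sub>R axis (loc k t) 1)"

definition storage_feasible ::
  "('n::finite, 'm::finite, 'k::finite) network \<Rightarrow> ('n, 'k) relocation \<Rightarrow> ('k \<Rightarrow> real) \<Rightarrow>
   'k \<Rightarrow> (nat \<Rightarrow> real) \<Rightarrow> bool" where
  "storage_feasible N loc s k uk \<longleftrightarrow>
     (\<forall>t\<in>{1..periods N}. 0 \<le> soc uk t \<and> soc uk t \<le> s k \<and>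
        - power_limit N loc s k t \<le> uk t \<and> uk t \<le> power_limit N loc s k t)"

definition mped_feasible ::
  "('n::finite, 'm::finite, 'k::finite) network \<Rightarrow> ('n, 'k) relocation \<Rightarrow> ('k \<Rightarrow> real) \<Rightarrow>
   (nat \<Rightarrow> real ^ 'n) \<Rightarrow> ('k \<Rightarrow> nat \<Rightarrow> real) \<Rightarrow> bool" where
  "mped_feasible N loc s g u \<longleftrightarrow>
     (\<forall>t\<in>{1..periods N}. 1 \<bullet> injection N loc g u t = 0 \<and>
        shift_factor N *v injection N loc g u t \<le> line_capacity N) \<and>
     (\<forall>k. storage_feasible N loc s k (u k))"

definition total_cost ::
  "('n::finite, 'm::finite, 'k::finite) network \<Rightarrow> (nat \<Rightarrow> real ^ 'n) \<Rightarrow> real" where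
  "total_cost N g = (\<Sum>t=1..periods N. \<Sum>i\<in>UNIV. gen_cost N i (g t $ i))"

definition mped_solution ::
  "('n::finite, 'm::finite, 'k::finite) network \<Rightarrow> ('n, 'k) relocation \<Rightarrow> ('k \<Rightarrow> real) \<Rightarrow>
   (nat \<Rightarrow> real ^ 'n) \<Rightarrow> ('k \<Rightarrow> nat \<Rightarrow> real) \<Rightarrow> bool" where
  "mped_solution N loc s g u \<longleftrightarrow>
     mped_feasible N loc s g u \<and>
     (\<forall>g' u'. mped_feasible N loc s g' u' \<longrightarrow> total_cost N g \<le> total_cost N g')"

(* The costs are bounded below, so this infimum is the genuine optimal value
   whenever the problem is feasible. *)
definition optimal_value ::
  "('n::finite, 'm::finite, 'k::finite) network \<Rightarrow> ('n, 'k) relocation \<Rightarrow> ('k \<Rightarrow> real) \<Rightarrow> real" where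
  "optimal_value N loc s = Inf {total_cost N g | g u. mped_feasible N loc s g u}"

definition marginal_value ::
  "('n::finite, 'm::finite, 'k::finite) network \<Rightarrow> ('n, 'k) relocation \<Rightarrow> ('k \<Rightarrow> real) \<Rightarrow> 'k \<Rightarrow> real" where
  "marginal_value N loc s k = - deriv (\<lambda>x. optimal_value N loc (s(k := x))) (s k)"

datatype ('m, 'k) constraint =
    Balance nat
  | Line nat "'m + 'm"
  | Energy_Lower 'k nat
  | Energy_Upper 'k nat
  | Power_Lower 'k nat
  | Power_Upper 'k nat

definition constraints ::
  "('n::finite, 'm::finite, 'k::finite) network \<Rightarrow> ('m, 'k) constraint set" where
  "constraints N =
     (\<Union>t\<in>{1..periods N}. {Balance t} \<union> range (Line t) \<union>
        (\<Union>k. {Energy_Lower k t, Energy_Upper k t, Power_Lower k t, Power_Upper k t}))"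

(* The constraint reads residual = 0 for Balance and residual \<le> 0 otherwise. *)
fun residual ::
  "('n::finite, 'm::finite, 'k::finite) network \<Rightarrow> ('n, 'k) relocation \<Rightarrow> ('k \<Rightarrow> real) \<Rightarrow>
   ('m, 'k) constraint \<Rightarrow> (nat \<Rightarrow> real ^ 'n) \<Rightarrow> ('k \<Rightarrow> nat \<Rightarrow> real) \<Rightarrow> real" where
  "residual N loc s (Balance t) g u = 1 \<bullet> injection N loc g u t"
| "residual N loc s (Line t l) g u =
     (shift_factor N *v injection N loc g u t) $ l - line_capacity N $ l"
| "residual N loc s (Energy_Lower k t) g u = - soc (u k) t"
| "residual N loc s (Energy_Upper k t) g u = soc (u k) t - s k"
| "residual N loc s (Power_Lower k t) g u = - u k t - power_limit N loc s k t"
| "residual N loc s (Power_Upper k t) g u = u k t - power_limit N loc s k t"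

definition binding_constraints ::
  "('n::finite, 'm::finite, 'k::finite) network \<Rightarrow> ('n, 'k) relocation \<Rightarrow> ('k \<Rightarrow> real) \<Rightarrow>
   (nat \<Rightarrow> real ^ 'n) \<Rightarrow> ('k \<Rightarrow> nat \<Rightarrow> real) \<Rightarrow> ('m, 'k) constraint set" where
  "binding_constraints N loc s g u = {c \<in> constraints N. residual N loc s c g u = 0}"

(* The residuals are affine, so residual c g' u' - residual c g u is the gradient of c applied
   to the displacement from (g, u) to (g', u'): this is linear independence of the family
   (not merely the set) of gradients of the binding constraints. *)
definition licq_at ::
  "('n::finite, 'm::finite, 'k::finite) network \<Rightarrow> ('n, 'k) relocation \<Rightarrow> ('k \<Rightarrow> real) \<Rightarrow>
   (nat \<Rightarrow> real ^ 'n) \<Rightarrow> ('k \<Rightarrow> nat \<Rightarrow> real) \<Rightarrow> bool" where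
  "licq_at N loc s g u \<longleftrightarrow>
     (\<forall>a. (\<forall>g' u'. (\<Sum>c\<in>binding_constraints N loc s g u.
                     a c * (residual N loc s c g' u' - residual N loc s c g u)) = 0)
          \<longrightarrow> (\<forall>c\<in>binding_constraints N loc s g u. a c = 0))"

definition lagrangian ::
  "('n::finite, 'm::finite, 'k::finite) network \<Rightarrow> ('n, 'k) relocation \<Rightarrow> ('k \<Rightarrow> real) \<Rightarrow>
   (nat \<Rightarrow> real) \<Rightarrow> (nat \<Rightarrow> real ^ ('m + 'm)) \<Rightarrow>
   ('k \<Rightarrow> nat \<Rightarrow> real) \<Rightarrow> ('k \<Rightarrow> nat \<Rightarrow> real) \<Rightarrow> ('k \<Rightarrow> nat \<Rightarrow> real) \<Rightarrow> ('k \<Rightarrow> nat \<Rightarrow> real) \<Rightarrow>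
   (nat \<Rightarrow> real ^ 'n) \<Rightarrow> ('k \<Rightarrow> nat \<Rightarrow> real) \<Rightarrow> real" where
  "lagrangian N loc s \<gamma> \<beta> \<nu> \<mu> \<omega> \<phi> g u =
     (\<Sum>t=1..periods N.
        (\<Sum>i\<in>UNIV. gen_cost N i (g t $ i))
        - \<gamma> t * (1 \<bullet> injection N loc g u t)
        + \<beta> t \<bullet> (shift_factor N *v injection N loc g u t - line_capacity N))
     + (\<Sum>k\<in>UNIV. \<Sum>t=1..periods N.
        \<mu> k t * (soc (u k) t - s k) - \<nu> k t * soc (u k) t
        + \<phi> k t * (u k t - power_limit N loc s k t)
        - \<omega> k t * (u k t + power_limit N loc s k t))"

(* Extended-real valued, as the Lagrangian may be unbounded below. *)
definition dual_function ::
  "('n::finite, 'm::finite, 'k::finite) network \<Rightarrow> ('n, 'k) relocation \<Rightarrow> ('k \<Rightarrow> real) \<Rightarrow>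
   (nat \<Rightarrow> real) \<Rightarrow> (nat \<Rightarrow> real ^ ('m + 'm)) \<Rightarrow>
   ('k \<Rightarrow> nat \<Rightarrow> real) \<Rightarrow> ('k \<Rightarrow> nat \<Rightarrow> real) \<Rightarrow> ('k \<Rightarrow> nat \<Rightarrow> real) \<Rightarrow> ('k \<Rightarrow> nat \<Rightarrow> real) \<Rightarrow> ereal" where
  "dual_function N loc s \<gamma> \<beta> \<nu> \<mu> \<omega> \<phi> =
     (INF (g, u)\<in>UNIV. ereal (lagrangian N loc s \<gamma> \<beta> \<nu> \<mu> \<omega> \<phi> g u))"

definition dual_feasible ::
  "('n::finite, 'm::finite, 'k::finite) network \<Rightarrow> (nat \<Rightarrow> real ^ ('m + 'm)) \<Rightarrow>
   ('k \<Rightarrow> nat \<Rightarrow> real) \<Rightarrow> ('k \<Rightarrow> nat \<Rightarrow> real) \<Rightarrow> ('k \<Rightarrow> nat \<Rightarrow> real) \<Rightarrow> ('k \<Rightarrow> nat \<Rightarrow> real) \<Rightarrow> bool" where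
  "dual_feasible N \<beta> \<nu> \<mu> \<omega> \<phi> \<longleftrightarrow>
     (\<forall>t\<in>{1..periods N}. 0 \<le> \<beta> t \<and>
        (\<forall>k. 0 \<le> \<nu> k t \<and> 0 \<le> \<mu> k t \<and> 0 \<le> \<omega> k t \<and> 0 \<le> \<phi> k t))"

definition dual_optimal ::
  "('n::finite, 'm::finite, 'k::finite) network \<Rightarrow> ('n, 'k) relocation \<Rightarrow> ('k \<Rightarrow> real) \<Rightarrow>
   (nat \<Rightarrow> real) \<Rightarrow> (nat \<Rightarrow> real ^ ('m + 'm)) \<Rightarrow>
   ('k \<Rightarrow> nat \<Rightarrow> real) \<Rightarrow> ('k \<Rightarrow> nat \<Rightarrow> real) \<Rightarrow> ('k \<Rightarrow> nat \<Rightarrow> real) \<Rightarrow> ('k \<Rightarrow> nat \<Rightarrow> real) \<Rightarrow> bool" where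
  "dual_optimal N loc s \<gamma> \<beta> \<nu> \<mu> \<omega> \<phi> \<longleftrightarrow>
     dual_feasible N \<beta> \<nu> \<mu> \<omega> \<phi> \<and>
     (\<forall>\<gamma>' \<beta>' \<nu>' \<mu>' \<omega>' \<phi>'. dual_feasible N \<beta>' \<nu>' \<mu>' \<omega>' \<phi>' \<longrightarrow>
        dual_function N loc s \<gamma>' \<beta>' \<nu>' \<mu>' \<omega>' \<phi>' \<le> dual_function N loc s \<gamma> \<beta> \<nu> \<mu> \<omega> \<phi>)"

(* Vanishes outside the horizon, in particular at periods N + 1. *)
definition lmp ::
  "('n::finite, 'm::finite, 'k::finite) network \<Rightarrow> (nat \<Rightarrow> real) \<Rightarrow> (nat \<Rightarrow> real ^ ('m + 'm)) \<Rightarrow>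
   nat \<Rightarrow> real ^ 'n" where
  "lmp N \<gamma> \<beta> t =
     (if t \<in> {1..periods N} then \<gamma> t *\<^sub>R 1 - transpose (shift_factor N) *v \<beta> t else 0)"

definition arbitrage_profit ::
  "('n::finite, 'm::finite, 'k::finite) network \<Rightarrow> ('n, 'k) relocation \<Rightarrow>
   (nat \<Rightarrow> real ^ 'n) \<Rightarrow> 'k \<Rightarrow> (nat \<Rightarrow> real) \<Rightarrow> real" where
  "arbitrage_profit N loc price k uk = - (\<Sum>t=1..periods N. price t $ loc k t * uk t)"

definition arbitrage_solution ::
  "('n::finite, 'm::finite, 'k::finite) network \<Rightarrow> ('n, 'k) relocation \<Rightarrow> ('k \<Rightarrow> real) \<Rightarrow>
   (nat \<Rightarrow> real ^ 'n) \<Rightarrow> 'k \<Rightarrow> (nat \<Rightarrow> real) \<Rightarrow> bool" where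
  "arbitrage_solution N loc s price k uk \<longleftrightarrow>
     storage_feasible N loc s k uk \<and>
     (\<forall>vk. storage_feasible N loc s k vk \<longrightarrow>
        arbitrage_profit N loc price k vk \<le> arbitrage_profit N loc price k uk)"

(* Uniqueness is meant on the horizon, where operations are vectors indexed by the periods. *)
definition unique_arbitrage_solution ::
  "('n::finite, 'm::finite, 'k::finite) network \<Rightarrow> ('n, 'k) relocation \<Rightarrow> ('k \<Rightarrow> real) \<Rightarrow>
   (nat \<Rightarrow> real ^ 'n) \<Rightarrow> 'k \<Rightarrow> (nat \<Rightarrow> real) \<Rightarrow> bool" where
  "unique_arbitrage_solution N loc s price k uk \<longleftrightarrow>
     arbitrage_solution N loc s price k uk \<and>
     (\<forall>vk. arbitrage_solution N loc s price k vk \<longrightarrow> (\<forall>t\<in>{1..periods N}. vk t = uk t))"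

definition energy_times ::
  "('n::finite, 'm::finite, 'k::finite) network \<Rightarrow> ('k \<Rightarrow> real) \<Rightarrow> 'k \<Rightarrow> (nat \<Rightarrow> real) \<Rightarrow> nat set" where
  "energy_times N s k uk = {t \<in> {1..periods N}. soc uk t = 0 \<or> soc uk t = s k}"

definition power_times ::
  "('n::finite, 'm::finite, 'k::finite) network \<Rightarrow> ('n, 'k) relocation \<Rightarrow> ('k \<Rightarrow> real) \<Rightarrow> 'k \<Rightarrow>
   (nat \<Rightarrow> real) \<Rightarrow> nat set" where
  "power_times N loc s k uk =
     {t \<in> {1..periods N}. uk t = - power_limit N loc s k t \<or> uk t = power_limit N loc s k t}"

(* energy_times and power_times need not partition the horizon, even under LICQ: a period may bind
   neither kind of constraint while another one binds both. For instance, a unit at a single bus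
   with capacity 3/2, power limit 1 and prices 1, 2, 10 operates as 1, 0, -1; period 2 then lies
   in neither set and period 3 in both. *)

(* The least element of Te after t, and T + 1 if there is none. For t in Te this is the successor
   of t in the increasing enumeration of Te, closed off by T + 1; for other t it is sigma(t). *)
definition next_energy_time :: "nat \<Rightarrow> nat set \<Rightarrow> nat \<Rightarrow> nat" where
  "next_energy_time T Te t = Inf {\<tau> \<in> insert (T + 1) Te. t < \<tau>}"

end

theory Submission
  imports Defs
begin

text \<open>
  LICQ makes the gradients of the binding constraints attain all values simultaneously. Hence
  Lagrange multipliers exist, strong duality holds, and every dual optimum forms a saddle point of the
  Lagrangian with the given solution. When the capacity of unit \<open>k\<close> changes, the Lagrangian at the
  fixed multipliers bounds the optimal value from below, and moving the solution so that the binding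
  constraints remain binding bounds it from above. Both bounds are differentiable and agree at
  \<open>s k\<close>, so they have the same derivative there, which is therefore that of the optimal value.
  The Lagrangian is affine in the operation of unit \<open>k\<close>, and the vanishing of its slope expresses the
  price at \<open>t\<close> through the multipliers from \<open>t\<close> onwards; subtracting these equations at \<open>t\<close> and at
  the next energy-constrained time leaves only the multipliers at \<open>t\<close>.
\<close>

subsection \<open>Independent linear functionals\<close>

text \<open>A subspace of the functions on an index type. An element lists the values that a family
  of linear functionals takes at one vector, so restricting it to \<open>B\<close> selects finitely
  many functionals while the others stay available.\<close>

definition linear_closed :: "('i \<Rightarrow> real) set \<Rightarrow> bool" where
  "linear_closed S \<longleftrightarrow> S \<noteq> {} \<and> (\<forall>v\<in>S. \<forall>w\<in>S. \<forall>a b. (\<lambda>i. a * v i + b * w i) \<in> S)"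

lemma linear_closed_combination:
  assumes "linear_closed S" "v \<in> S" "w \<in> S"
  shows "(\<lambda>i. a * v i + b * w i) \<in> S"
  using assms unfolding linear_closed_def by blast

lemma linear_closed_sum:
  assumes S: "linear_closed S" and "finite B" and "\<And>c. c \<in> B \<Longrightarrow> e c \<in> S"
  shows "(\<lambda>i. \<Sum>c\<in>B. a c * e c i) \<in> S"
  using assms(2,3)
proof (induction B)
  case empty
  obtain v where "v \<in> S"
    using S unfolding linear_closed_def by blast
  from linear_closed_combination[OF S this this, of 0 0] show ?case
    by simp
next
  case (insert x F)
  have "(\<lambda>i. a x * e x i + 1 * (\<Sum>c\<in>F. a c * e c i)) \<in> S"
    using insert by (intro linear_closed_combination[OF S]) auto
  then show ?case
    using insert by simp
qed

text \<open>Induction on \<open>B\<close>. The functionals in \<open>B\<close> are jointly onto, so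
  they have a dual basis \<open>e\<close>. Independence of \<open>b\<close> from them yields an
  element that vanishes on \<open>B\<close> but not at \<open>b\<close>, and a multiple of it
  corrects the value at \<open>b\<close>. No dimension count on \<open>S\<close> enters.\<close>

lemma independent_imp_surjective:
  assumes "finite B" and S: "linear_closed S"
    and "\<And>p. \<forall>v\<in>S. (\<Sum>c\<in>B. p c * v c) = 0 \<Longrightarrow> \<forall>c\<in>B. p c = 0"
  shows "\<exists>v\<in>S. \<forall>c\<in>B. v c = r c"
  using assms(1,3)
proof (induction B arbitrary: r)
  case empty
  then show ?case
    using S unfolding linear_closed_def by blast
next
  case (insert b B)
  have onto: "\<exists>v\<in>S. \<forall>c\<in>B. v c = q c" for q
  proof (rule insert.IH)
    fix p :: "'a \<Rightarrow> real"
    assume p: "\<forall>v\<in>S. (\<Sum>c\<in>B. p c * v c) = 0"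
    have "(\<Sum>c\<in>insert b B. (p(b := 0)) c * v c) = (\<Sum>c\<in>B. p c * v c)" for v
      using insert.hyps by (simp, intro sum.cong) auto
    then have "\<forall>c\<in>insert b B. (p(b := 0)) c = 0"
      using p by (intro insert.prems) auto
    then show "\<forall>c\<in>B. p c = 0"
      using insert.hyps by (metis fun_upd_other insertI2)
  qed
  have "\<forall>c. \<exists>v. v \<in> S \<and> (\<forall>c'\<in>B. v c' = (if c' = c then 1 else 0))"
    using onto[of "\<lambda>c'. if c' = c then 1 else 0" for c] by blast
  then obtain e where e: "\<And>c. e c \<in> S" "\<And>c c'. c' \<in> B \<Longrightarrow> e c c' = (if c' = c then 1 else 0)"
    by metis
  \<comment> \<open>If coordinate \<open>b\<close> were a combination of the coordinates in
    \<open>B\<close>, evaluating it at the dual basis would give the coefficients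
    \<open>e c b\<close>. Since \<open>p b = - 1\<close>, independence excludes this
    relation.\<close>
  define p where "p c = (if c = b then - 1 else e c b)" for c
  have "\<exists>v\<in>S. (\<Sum>c\<in>insert b B. p c * v c) \<noteq> 0"
    using insert.prems[of p] unfolding p_def by auto
  then obtain v where v: "v \<in> S" "(\<Sum>c\<in>insert b B. p c * v c) \<noteq> 0"
    by blast
  have sum_p: "(\<Sum>c\<in>insert b B. p c * v c) = (\<Sum>c\<in>B. v c * e c b) - v b"
    using insert.hyps by (simp add: p_def, intro sum.cong) auto
  \<comment> \<open>Subtracting the part of \<open>v\<close> seen by \<open>B\<close> leaves an
    element that vanishes on \<open>B\<close>; its value at \<open>b\<close> is, up to sign, the
    nonzero defect of the relation above.\<close>
  define w where "w i = 1 * v i + (- 1) * (\<Sum>c\<in>B. v c * e c i)" for i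
  have wS: "w \<in> S"
    unfolding w_def using v(1) e(1) insert.hyps
    by (intro linear_closed_combination[OF S] linear_closed_sum[OF S]) auto
  have w0: "w c' = 0" if "c' \<in> B" for c'
  proof -
    have "(\<Sum>c\<in>B. v c * e c c') = (\<Sum>c\<in>B. if c' = c then v c else 0)"
      using e(2)[OF that] by (intro sum.cong) auto
    then show ?thesis
      using that insert.hyps by (simp add: w_def)
  qed
  have wb: "w b \<noteq> 0"
    using v(2) unfolding sum_p w_def by simp
  obtain x where x: "x \<in> S" "\<forall>c\<in>B. x c = r c"
    using onto by blast
  define z where "z i = 1 * x i + ((r b - x b) / w b) * w i" for i
  have "z \<in> S"
    unfolding z_def using x wS by (intro linear_closed_combination[OF S])
  moreover have "\<forall>c\<in>insert b B. z c = r c"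
    using x w0 wb by (auto simp: z_def)
  ultimately show ?case
    by blast
qed

text \<open>Here \<open>I\<close> marks the inequalities and \<open>j\<close> the objective.
  Removing from \<open>v\<close> its part along the dual basis \<open>e\<close> leaves a direction
  on which all of \<open>B\<close> vanishes, so the objective vanishes there too. The objective is
  thus determined by the values on \<open>B\<close>, with multipliers
  \<open>- e c j\<close>.\<close>

lemma lagrange_multipliers:
  assumes fin: "finite B" and S: "linear_closed S"
    and onto: "\<And>r. \<exists>v\<in>S. \<forall>c\<in>B. v c = r c"
    and opt: "\<And>v. v \<in> S \<Longrightarrow> \<forall>c\<in>B. v c \<le> 0 \<Longrightarrow> \<forall>c\<in>B - I. v c = 0 \<Longrightarrow> 0 \<le> v j"
  shows "\<exists>y. (\<forall>c\<in>B \<inter> I. 0 \<le> y c) \<and> (\<forall>v\<in>S. v j + (\<Sum>c\<in>B. y c * v c) = 0)"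
proof -
  have "\<forall>c. \<exists>v. v \<in> S \<and> (\<forall>c'\<in>B. v c' = (if c' = c then 1 else 0))"
    using onto[of "\<lambda>c'. if c' = c then 1 else 0" for c] by blast
  then obtain e where e: "\<And>c. e c \<in> S" "\<And>c c'. c' \<in> B \<Longrightarrow> e c c' = (if c' = c then 1 else 0)"
    by metis
  have neg: "(\<lambda>i. - v i) \<in> S" if "v \<in> S" for v
    using linear_closed_combination[OF S that that, of "- 1" 0] by simp
  \<comment> \<open>Moving along \<open>- e c\<close> relaxes the inequality \<open>c\<close> alone
    and keeps every other functional in \<open>B\<close> at zero, so optimality applies.\<close>
  have "0 \<le> - e c j" if "c \<in> B \<inter> I" for c
    using that e(2) by (intro opt[OF neg[OF e(1)]]) auto
  moreover have "v j + (\<Sum>c\<in>B. - e c j * v c) = 0" if v: "v \<in> S" for v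
  proof -
    define w where "w i = 1 * v i + (- 1) * (\<Sum>c\<in>B. v c * e c i)" for i
    have wS: "w \<in> S"
      unfolding w_def using v e(1) fin
      by (intro linear_closed_combination[OF S] linear_closed_sum[OF S]) auto
    have w0: "w c' = 0" if "c' \<in> B" for c'
    proof -
      have "(\<Sum>c\<in>B. v c * e c c') = (\<Sum>c\<in>B. if c' = c then v c else 0)"
        using e(2)[OF that] by (intro sum.cong) auto
      then show ?thesis
        using that fin by (simp add: w_def)
    qed
    \<comment> \<open>Both \<open>w\<close> and its negative are admissible directions.\<close>
    have "w j = 0"
      using opt[OF wS] opt[OF neg[OF wS]] w0 by fastforce
    then show ?thesis
      by (simp add: w_def sum_negf mult.commute)
  qed
  ultimately show ?thesis
    by (intro exI[of _ "\<lambda>c. - e c j"]) blast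
qed

subsection \<open>Constraints as affine functionals\<close>

text \<open>The linear part of \<open>injection\<close>: the constant load is dropped.\<close>

definition net_injection ::
  "('n::finite, 'k::finite) relocation \<Rightarrow> (nat \<Rightarrow> real ^ 'n) \<Rightarrow> ('k \<Rightarrow> nat \<Rightarrow> real) \<Rightarrow> nat \<Rightarrow> real ^ 'n" where
  "net_injection loc h v t = h t - (\<Sum>k\<in>UNIV. v k t *\<^sub>R axis (loc k t) 1)"

lemma net_injection_linear:
  "net_injection loc (\<lambda>t. a *\<^sub>R h t + b *\<^sub>R h' t) (\<lambda>k t. a * v k t + b * v' k t) t =
     a *\<^sub>R net_injection loc h v t + b *\<^sub>R net_injection loc h' v' t"
  by (simp add: net_injection_def algebra_simps sum.distrib scaleR_sum_right)

lemma injection_add: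
  "injection N loc (\<lambda>t. g t + h t) (\<lambda>k t. u k t + v k t) t =
     injection N loc g u t + net_injection loc h v t"
  by (simp add: injection_def net_injection_def algebra_simps sum.distrib)

lemma soc_linear: "soc (\<lambda>t. a * v t + b * w t) t = a * soc v t + b * soc w t"
  by (simp add: soc_def sum.distrib sum_distrib_left)

lemma soc_add: "soc (\<lambda>t. v t + w t) t = soc v t + soc w t"
  by (simp add: soc_def sum.distrib)

text \<open>The linear part of \<open>residual\<close>. Capacities enter the constraints only as
  constants, so the same gradients serve every \<open>s\<close>.\<close>

fun gradient ::
  "('n::finite, 'm::finite, 'k::finite) network \<Rightarrow> ('n, 'k) relocation \<Rightarrow> ('m, 'k) constraint \<Rightarrow>
   (nat \<Rightarrow> real ^ 'n) \<Rightarrow> ('k \<Rightarrow> nat \<Rightarrow> real) \<Rightarrow> real" where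
  "gradient N loc (Balance t) h v = 1 \<bullet> net_injection loc h v t"
| "gradient N loc (Line t l) h v = (shift_factor N *v net_injection loc h v t) $ l"
| "gradient N loc (Energy_Lower k t) h v = - soc (v k) t"
| "gradient N loc (Energy_Upper k t) h v = soc (v k) t"
| "gradient N loc (Power_Lower k t) h v = - v k t"
| "gradient N loc (Power_Upper k t) h v = v k t"

lemma gradient_linear:
  "gradient N loc c (\<lambda>t. a *\<^sub>R h t + b *\<^sub>R h' t) (\<lambda>k t. a * v k t + b * v' k t) =
     a * gradient N loc c h v + b * gradient N loc c h' v'"
  by (cases c) (simp_all add: net_injection_linear soc_linear inner_add_right
      matrix_vector_right_distrib matrix_vector_mult_scaleR algebra_simps)

lemma gradient_scale:
  "gradient N loc c (\<lambda>t. a *\<^sub>R h t) (\<lambda>k t. a * v k t) = a * gradient N loc c h v"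
  using gradient_linear[of N loc c a h 0 h v v] by simp

lemma residual_add:
  "residual N loc s c (\<lambda>t. g t + h t) (\<lambda>k t. u k t + v k t) =
     residual N loc s c g u + gradient N loc c h v"
  by (cases c) (simp_all add: injection_add soc_add inner_add_right matrix_vector_right_distrib)

lemma residual_diff:
  "residual N loc s c g' u' =
     residual N loc s c g u + gradient N loc c (\<lambda>t. g' t - g t) (\<lambda>k t. u' k t - u k t)"
  using residual_add[of N loc s c g "\<lambda>t. g' t - g t" u "\<lambda>k t. u' k t - u k t"] by simp

text \<open>Here \<open>a\<close> is the change of the energy capacity and \<open>b\<close> that of the power rating.\<close>

fun rhs_change ::
  "('n::finite, 'm::finite, 'k::finite) network \<Rightarrow> ('n, 'k) relocation \<Rightarrow> 'k \<Rightarrow> real \<Rightarrow> real \<Rightarrow>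
   ('m, 'k) constraint \<Rightarrow> real" where
  "rhs_change N loc k a b (Balance t) = 0"
| "rhs_change N loc k a b (Line t l) = 0"
| "rhs_change N loc k a b (Energy_Lower k' t) = 0"
| "rhs_change N loc k a b (Energy_Upper k' t) = (if k' = k then a else 0)"
| "rhs_change N loc k a b (Power_Lower k' t) = (if k' = k then b * storage_time N loc k t else 0)"
| "rhs_change N loc k a b (Power_Upper k' t) = (if k' = k then b * storage_time N loc k t else 0)"

lemma residual_capacity_change:
  "residual N loc (s(k := x)) c g u =
     residual N loc s c g u
       - rhs_change N loc k (x - s k) (power_rating N k x - power_rating N k (s k)) c"
  by (cases c) (simp_all add: power_limit_def algebra_simps)

lemma rhs_change_linear:
  "rhs_change N loc k a b c = a * rhs_change N loc k 1 0 c + b * rhs_change N loc k 0 1 c"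
  by (cases c) simp_all

lemma mem_constraints [simp]:
  "Balance t \<in> constraints N \<longleftrightarrow> t \<in> {1..periods N}"
  "Line t l \<in> constraints N \<longleftrightarrow> t \<in> {1..periods N}"
  "Energy_Lower k t \<in> constraints N \<longleftrightarrow> t \<in> {1..periods N}"
  "Energy_Upper k t \<in> constraints N \<longleftrightarrow> t \<in> {1..periods N}"
  "Power_Lower k t \<in> constraints N \<longleftrightarrow> t \<in> {1..periods N}"
  "Power_Upper k t \<in> constraints N \<longleftrightarrow> t \<in> {1..periods N}"
  unfolding constraints_def by blast+

lemma finite_constraints [simp]: "finite (constraints N)"
  unfolding constraints_def by (intro finite_UN_I finite_UnI) auto

text \<open>Splits a sum over the constraints into the network part by period and the storage part
  by unit and period, which is the shape of \<open>lagrangian\<close>.\<close>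

lemma sum_constraints:
  fixes f :: "('m::finite, 'k::finite) constraint \<Rightarrow> real"
    and N :: "('n::finite, 'm, 'k) network"
  shows "(\<Sum>c\<in>constraints N. f c) =
    (\<Sum>t=1..periods N. f (Balance t) + (\<Sum>l\<in>UNIV. f (Line t l))) +
    (\<Sum>k\<in>UNIV. \<Sum>t=1..periods N. f (Energy_Lower k t) + f (Energy_Upper k t)
       + f (Power_Lower k t) + f (Power_Upper k t))"
proof -
  define A :: "nat \<Rightarrow> ('m, 'k) constraint set" where "A t = {Balance t} \<union> range (Line t) \<union>
      (\<Union>k. {Energy_Lower k t, Energy_Upper k t, Power_Lower k t, Power_Upper k t})"
    for t
  have A: "sum f (A t) = f (Balance t) + (\<Sum>l\<in>UNIV. f (Line t l)) +
      (\<Sum>k\<in>UNIV. f (Energy_Lower k t) + f (Energy_Upper k t)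
         + f (Power_Lower k t) + f (Power_Upper k t))" for t
  proof -
    have "sum f (A t) = sum f ({Balance t} \<union> range (Line t)) + sum f
        (\<Union>k. {Energy_Lower k t, Energy_Upper k t, Power_Lower k t, Power_Upper k t})"
      unfolding A_def by (intro sum.union_disjoint) auto
    also have "sum f ({Balance t} \<union> range (Line t)) = f (Balance t) + (\<Sum>l\<in>UNIV. f (Line t l))"
    proof -
      have "sum f (range (Line t)) = (\<Sum>l\<in>UNIV. f (Line t l))"
        by (subst sum.reindex) (auto simp: inj_on_def)
      then show ?thesis
        by (subst sum.union_disjoint) auto
    qed
    also have "sum f (\<Union>k. {Energy_Lower k t, Energy_Upper k t, Power_Lower k t, Power_Upper k t})
        = (\<Sum>k\<in>UNIV. f (Energy_Lower k t) + f (Energy_Upper k t)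
         + f (Power_Lower k t) + f (Power_Upper k t))"
      by (subst sum.UNION_disjoint) (auto simp: add.assoc)
    finally show ?thesis .
  qed
  have "(\<Sum>c\<in>constraints N. f c) = (\<Sum>t=1..periods N. sum f (A t))"
    unfolding constraints_def A_def by (rule sum.UNION_disjoint) auto
  also have "\<dots> = (\<Sum>t=1..periods N. f (Balance t) + (\<Sum>l\<in>UNIV. f (Line t l))) +
    (\<Sum>t=1..periods N. \<Sum>k\<in>UNIV. f (Energy_Lower k t) + f (Energy_Upper k t)
       + f (Power_Lower k t) + f (Power_Upper k t))"
    by (simp add: A sum.distrib)
  finally show ?thesis
    by (simp only: sum.swap[where A = "{1..periods N}" and B = "UNIV :: 'k set"])
qed

text \<open>Gathers the dual variables into one function on constraints. The sign at
  \<open>Balance\<close> reflects that the Lagrangian subtracts the balance term.\<close>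

fun multiplier ::
  "(nat \<Rightarrow> real) \<Rightarrow> (nat \<Rightarrow> real ^ ('m::finite + 'm)) \<Rightarrow> ('k \<Rightarrow> nat \<Rightarrow> real) \<Rightarrow> ('k \<Rightarrow> nat \<Rightarrow> real) \<Rightarrow>
   ('k \<Rightarrow> nat \<Rightarrow> real) \<Rightarrow> ('k \<Rightarrow> nat \<Rightarrow> real) \<Rightarrow> ('m, 'k) constraint \<Rightarrow> real" where
  "multiplier \<gamma> \<beta> \<nu> \<mu> \<omega> \<phi> (Balance t) = - \<gamma> t"
| "multiplier \<gamma> \<beta> \<nu> \<mu> \<omega> \<phi> (Line t l) = \<beta> t $ l"
| "multiplier \<gamma> \<beta> \<nu> \<mu> \<omega> \<phi> (Energy_Lower k t) = \<nu> k t"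
| "multiplier \<gamma> \<beta> \<nu> \<mu> \<omega> \<phi> (Energy_Upper k t) = \<mu> k t"
| "multiplier \<gamma> \<beta> \<nu> \<mu> \<omega> \<phi> (Power_Lower k t) = \<omega> k t"
| "multiplier \<gamma> \<beta> \<nu> \<mu> \<omega> \<phi> (Power_Upper k t) = \<phi> k t"

lemma lagrangian_eq:
  "lagrangian N loc s \<gamma> \<beta> \<nu> \<mu> \<omega> \<phi> g u =
     total_cost N g
       + (\<Sum>c\<in>constraints N. multiplier \<gamma> \<beta> \<nu> \<mu> \<omega> \<phi> c * residual N loc s c g u)"
  unfolding lagrangian_def total_cost_def sum_constraints
  by (simp add: sum.distrib inner_vec_def algebra_simps sum_subtractf)

lemma mped_feasible_iff:
  "mped_feasible N loc s g u \<longleftrightarrow>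
     (\<forall>c\<in>constraints N. residual N loc s c g u \<le> 0 \<and>
        (c \<in> range Balance \<longrightarrow> residual N loc s c g u = 0))"
  (is "?L \<longleftrightarrow> ?R")
proof
  assume ?L
  then show ?R
    unfolding mped_feasible_def storage_feasible_def constraints_def
    by (auto simp: less_eq_vec_def) (metis atLeastAtMost_iff minus_le_iff)
next
  assume R: ?R
  have bal: "1 \<bullet> injection N loc g u t = 0"
    and line: "shift_factor N *v injection N loc g u t \<le> line_capacity N"
    if t: "t \<in> {1..periods N}" for t
  proof -
    have "Balance t \<in> constraints N" "Line t l \<in> constraints N" for l
      using t by auto
    then have "residual N loc s (Balance t) g u = 0" "residual N loc s (Line t l) g u \<le> 0" for l
      using R by blast+
    then show "1 \<bullet> injection N loc g u t = 0"
      "shift_factor N *v injection N loc g u t \<le> line_capacity N"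
      by (auto simp: less_eq_vec_def)
  qed
  have "storage_feasible N loc s k (u k)" for k
    unfolding storage_feasible_def
  proof
    fix t assume t: "t \<in> {1..periods N}"
    have "{Energy_Lower k t, Energy_Upper k t, Power_Lower k t, Power_Upper k t} \<subseteq> constraints N"
      using t by auto
    then have "residual N loc s (Energy_Lower k t) g u \<le> 0" "residual N loc s (Energy_Upper k t) g u \<le> 0"
      "residual N loc s (Power_Lower k t) g u \<le> 0" "residual N loc s (Power_Upper k t) g u \<le> 0"
      using R by blast+
    then show "0 \<le> soc (u k) t \<and> soc (u k) t \<le> s k \<and>
        - power_limit N loc s k t \<le> u k t \<and> u k t \<le> power_limit N loc s k t"
      by auto
  qed
  then show ?L
    using bal line unfolding mped_feasible_def by blast
qed

subsection \<open>Strong duality\<close>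

definition cost_gradient ::
  "('n::finite, 'm::finite, 'k::finite) network \<Rightarrow> (nat \<Rightarrow> real ^ 'n) \<Rightarrow> (nat \<Rightarrow> real ^ 'n) \<Rightarrow> real" where
  "cost_gradient N g h = (\<Sum>t=1..periods N. \<Sum>i\<in>UNIV. deriv (gen_cost N i) (g t $ i) * h t $ i)"

lemma cost_gradient_linear:
  "cost_gradient N g (\<lambda>t. a *\<^sub>R h t + b *\<^sub>R h' t) = a * cost_gradient N g h + b * cost_gradient N g h'"
  by (simp add: cost_gradient_def sum_distrib_left sum.distrib algebra_simps)

lemma strictly_convex_quadratic_expansion:
  assumes "strictly_convex_quadratic f"
  shows "\<exists>a>0. \<forall>x y. f (x + y) = f x + deriv f x * y + a * y\<^sup>2"
proof -
  obtain a b c where a: "a > 0" and "\<forall>x. f x = a * x\<^sup>2 + b * x + c"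
    using assms unfolding strictly_convex_quadratic_def by blast
  then have f: "f = (\<lambda>x. a * x\<^sup>2 + b * x + c)"
    by blast
  have "deriv f x = 2 * a * x + b" for x
    unfolding f by (rule DERIV_imp_deriv) (auto intro!: derivative_eq_intros)
  then have "f (x + y) = f x + deriv f x * y + a * y\<^sup>2" for x y
    by (simp add: f power2_eq_square algebra_simps)
  then show ?thesis
    using a by blast
qed

text \<open>For quadratic costs the second-order expansion is exact. Nonnegativity of the remainder
  \<open>Q\<close> turns stationarity into global optimality, and its homogeneity makes it
  negligible for small steps.\<close>

lemma total_cost_expansion:
  assumes "network_data N"
  obtains Q where "\<And>g h. total_cost N (\<lambda>t. g t + h t) = total_cost N g + cost_gradient N g h + Q h"
    and "\<And>h. 0 \<le> Q h" and "\<And>a h. Q (\<lambda>t. a *\<^sub>R h t) = a\<^sup>2 * Q h"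
proof -
  have "\<forall>i. \<exists>a>0. \<forall>x y. gen_cost N i (x + y) = gen_cost N i x + deriv (gen_cost N i) x * y + a * y\<^sup>2"
    using assms strictly_convex_quadratic_expansion unfolding network_data_def by blast
  then obtain a where a: "\<And>i. a i > 0"
    and cost: "\<And>i x y. gen_cost N i (x + y) = gen_cost N i x + deriv (gen_cost N i) x * y + a i * y\<^sup>2"
    by metis
  show thesis
  proof (rule that[of "\<lambda>h. \<Sum>t=1..periods N. \<Sum>i\<in>UNIV. a i * (h t $ i)\<^sup>2"])
    show "total_cost N (\<lambda>t. g t + h t) = total_cost N g + cost_gradient N g h
        + (\<Sum>t=1..periods N. \<Sum>i\<in>UNIV. a i * (h t $ i)\<^sup>2)" for g h
      by (simp add: total_cost_def cost_gradient_def cost sum.distrib)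
    show "0 \<le> (\<Sum>t=1..periods N. \<Sum>i\<in>UNIV. a i * (h t $ i)\<^sup>2)" for h :: "nat \<Rightarrow> real ^ 'a"
      using a by (intro sum_nonneg mult_nonneg_nonneg) (auto simp: less_imp_le)
    show "(\<Sum>t=1..periods N. \<Sum>i\<in>UNIV. a i * ((b *\<^sub>R h t) $ i)\<^sup>2) =
        b\<^sup>2 * (\<Sum>t=1..periods N. \<Sum>i\<in>UNIV. a i * (h t $ i)\<^sup>2)" for b and h :: "nat \<Rightarrow> real ^ 'a"
      by (simp add: sum_distrib_left power_mult_distrib mult_ac)
  qed
qed

text \<open>Nonbinding constraints have negative residual and stay satisfied by continuity, so only
  the binding ones need checking. This serves both small steps at fixed capacity and small changes
  of the capacity.\<close>

lemma eventually_feasible: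
  assumes feas: "mped_feasible N loc s g u"
    and lim: "\<And>c. c \<in> constraints N \<Longrightarrow>
      ((\<lambda>x. residual N loc (S x) c (G x) (U x)) \<longlongrightarrow> residual N loc s c g u) F"
    and binding: "\<And>c. c \<in> binding_constraints N loc s g u \<Longrightarrow>
      \<forall>\<^sub>F x in F. residual N loc (S x) c (G x) (U x) \<le> 0 \<and>
        (c \<in> range Balance \<longrightarrow> residual N loc (S x) c (G x) (U x) = 0)"
  shows "\<forall>\<^sub>F x in F. mped_feasible N loc (S x) (G x) (U x)"
  unfolding mped_feasible_iff
proof (rule eventually_ball_finite, simp, rule ballI)
  fix c assume c: "c \<in> constraints N"
  show "\<forall>\<^sub>F x in F. residual N loc (S x) c (G x) (U x) \<le> 0 \<and>
        (c \<in> range Balance \<longrightarrow> residual N loc (S x) c (G x) (U x) = 0)"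
  proof (cases "residual N loc s c g u = 0")
    case True
    then show ?thesis
      using c by (intro binding) (simp add: binding_constraints_def)
  next
    case False
    then have neg: "residual N loc s c g u < 0" and "c \<notin> range Balance"
      using feas c unfolding mped_feasible_iff by (auto simp: less_le)
    from order_tendstoD(2)[OF lim[OF c] neg] show ?thesis
      by eventually_elim (use \<open>c \<notin> range Balance\<close> in auto)
  qed
qed

lemma binding_subset: "binding_constraints N loc s g u \<subseteq> constraints N"
  unfolding binding_constraints_def by blast

lemma finite_binding: "finite (binding_constraints N loc s g u)"
  using finite_subset[OF binding_subset finite_constraints] .

text \<open>Directions are recorded through the values of all linear functionals of interest: the
  objective gradient at index \<open>None\<close> and the constraint gradients at the indices \<open>Some c\<close>.\<close>

definition direction_values ::
  "('n::finite, 'm::finite, 'k::finite) network \<Rightarrow> ('n, 'k) relocation \<Rightarrow> (nat \<Rightarrow> real ^ 'n) \<Rightarrow>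
   (('m, 'k) constraint option \<Rightarrow> real) set" where
  "direction_values N loc g =
     {case_option (cost_gradient N g h) (\<lambda>c. gradient N loc c h v) | h v. True}"

lemma linear_closed_direction_values: "linear_closed (direction_values N loc g)"
  unfolding linear_closed_def
proof (intro conjI ballI allI)
  show "direction_values N loc g \<noteq> {}"
    unfolding direction_values_def by blast
  fix p q a b
  assume "p \<in> direction_values N loc g" "q \<in> direction_values N loc g"
  then obtain h v h' v'
    where p: "p = case_option (cost_gradient N g h) (\<lambda>c. gradient N loc c h v)"
      and q: "q = case_option (cost_gradient N g h') (\<lambda>c. gradient N loc c h' v')"
    unfolding direction_values_def by blast
  have "(\<lambda>i. a * p i + b * q i) =
    case_option (cost_gradient N g (\<lambda>t. a *\<^sub>R h t + b *\<^sub>R h' t))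
      (\<lambda>c. gradient N loc c (\<lambda>t. a *\<^sub>R h t + b *\<^sub>R h' t) (\<lambda>k t. a * v k t + b * v' k t))"
    by (simp add: fun_eq_iff p q cost_gradient_linear gradient_linear split: option.split)
  then show "(\<lambda>i. a * p i + b * q i) \<in> direction_values N loc g"
    unfolding direction_values_def by blast
qed

text \<open>By \<open>residual_diff\<close>, the differences in \<open>licq_at\<close> are gradients
  applied to displacements, so LICQ is independence of the binding coordinates on
  \<open>direction_values\<close>.\<close>

lemma licq_surjective:
  assumes "licq_at N loc s g u"
  shows "\<exists>x\<in>direction_values N loc g. \<forall>c\<in>Some ` binding_constraints N loc s g u. x c = r c"
proof (rule independent_imp_surjective[OF _ linear_closed_direction_values])
  let ?B = "binding_constraints N loc s g u"
  show "finite (Some ` ?B)"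
    using finite_binding by blast
  fix p
  assume p: "\<forall>x\<in>direction_values N loc g. (\<Sum>c\<in>Some ` ?B. p c * x c) = 0"
  have "(\<Sum>c\<in>?B. p (Some c) * (residual N loc s c g' u' - residual N loc s c g u)) = 0" for g' u'
  proof -
    let ?x = "case_option (cost_gradient N g (\<lambda>t. g' t - g t))
      (\<lambda>c. gradient N loc c (\<lambda>t. g' t - g t) (\<lambda>k t. u' k t - u k t))"
    have "?x \<in> direction_values N loc g"
      unfolding direction_values_def by blast
    with p have "(\<Sum>c\<in>Some ` ?B. p c * ?x c) = 0"
      by blast
    then show ?thesis
      by (subst (asm) sum.reindex) (auto simp: residual_diff[of N loc s _ g' u' g u])
  qed
  then show "\<forall>c\<in>Some ` ?B. p c = 0"
    using assms[unfolded licq_at_def, rule_format, of "\<lambda>c. p (Some c)"] by blast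
qed

lemma licq_direction:
  assumes "licq_at N loc s g u"
  obtains h v where "\<And>c. c \<in> binding_constraints N loc s g u \<Longrightarrow> gradient N loc c h v = r c"
proof -
  obtain x where "x \<in> direction_values N loc g"
    and x: "\<forall>c\<in>Some ` binding_constraints N loc s g u. x c = r (the c)"
    using licq_surjective[OF assms, of "\<lambda>c. r (the c)"] by blast
  then obtain h v where "x = case_option (cost_gradient N g h) (\<lambda>c. gradient N loc c h v)"
    unfolding direction_values_def by blast
  with x show thesis
    by (intro that) auto
qed

text \<open>A small step along a direction that violates no binding constraint to first order stays
  feasible, since the residuals are affine. Dividing the cost increase by the step length and
  letting it tend to zero leaves the directional derivative.\<close>

lemma solution_no_descent:
  assumes "network_data N" and sol: "mped_solution N loc s g u"
    and grad: "\<And>c. c \<in> binding_constraints N loc s g u \<Longrightarrow> gradient N loc c h v \<le> 0"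
      "\<And>t. Balance t \<in> binding_constraints N loc s g u \<Longrightarrow> gradient N loc (Balance t) h v = 0"
  shows "0 \<le> cost_gradient N g h"
proof -
  obtain Q where Q: "\<And>g h. total_cost N (\<lambda>t. g t + h t) = total_cost N g + cost_gradient N g h + Q h"
    "\<And>h. 0 \<le> Q h" "\<And>a h. Q (\<lambda>t. a *\<^sub>R h t) = a\<^sup>2 * Q h"
    by (rule total_cost_expansion[OF assms(1)]) (rule that)
  have res: "residual N loc s c (\<lambda>t. g t + e *\<^sub>R h t) (\<lambda>k t. u k t + e * v k t) =
      residual N loc s c g u + e * gradient N loc c h v" for e c
    by (simp add: residual_add gradient_scale)
  have feas: "\<forall>\<^sub>F e in at_right 0. mped_feasible N loc s (\<lambda>t. g t + e *\<^sub>R h t) (\<lambda>k t. u k t + e * v k t)"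
  proof (rule eventually_feasible)
    show "mped_feasible N loc s g u"
      using sol unfolding mped_solution_def by blast
    show "((\<lambda>e. residual N loc s c (\<lambda>t. g t + e *\<^sub>R h t) (\<lambda>k t. u k t + e * v k t))
        \<longlongrightarrow> residual N loc s c g u) (at_right 0)" for c
      unfolding res by (auto intro!: tendsto_eq_intros)
    fix c assume c: "c \<in> binding_constraints N loc s g u"
    show "\<forall>\<^sub>F e in at_right 0.
        residual N loc s c (\<lambda>t. g t + e *\<^sub>R h t) (\<lambda>k t. u k t + e * v k t) \<le> 0 \<and>
        (c \<in> range Balance \<longrightarrow>
          residual N loc s c (\<lambda>t. g t + e *\<^sub>R h t) (\<lambda>k t. u k t + e * v k t) = 0)"
      unfolding res using eventually_at_right_less[of 0]
    proof eventually_elim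
      case (elim e)
      then show ?case
        using c grad(1)[OF c] grad(2)
        by (auto simp: binding_constraints_def mult_nonneg_nonpos)
    qed
  qed
  have "\<forall>\<^sub>F e in at_right 0. 0 \<le> cost_gradient N g h + e * Q h"
    using feas eventually_at_right_less[of 0]
  proof eventually_elim
    case (elim e)
    have "total_cost N g \<le> total_cost N (\<lambda>t. g t + e *\<^sub>R h t)"
      using sol elim(1) unfolding mped_solution_def by blast
    then have "0 \<le> e * (cost_gradient N g h + e * Q h)"
      using cost_gradient_linear[of N g e h 0 h]
      by (simp add: Q(1,3) power2_eq_square algebra_simps)
    then show ?case
      using elim(2) by (simp add: zero_le_mult_iff)
  qed
  moreover have "((\<lambda>e. cost_gradient N g h + e * Q h) \<longlongrightarrow> cost_gradient N g h) (at_right 0)"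
    by (auto intro!: tendsto_eq_intros)
  ultimately show ?thesis
    by (intro tendsto_lowerbound) auto
qed

text \<open>Multipliers on the binding constraints come from first-order optimality. Convexity then
  upgrades stationarity to the statement that the Lagrangian is nowhere below the optimal
  cost.\<close>

lemma kkt_multipliers_exist:
  assumes net: "network_data N" and sol: "mped_solution N loc s g u" and licq: "licq_at N loc s g u"
  obtains y where "\<And>c. c \<in> constraints N - range Balance \<Longrightarrow> 0 \<le> y c"
    and "\<And>g' u'. total_cost N g \<le>
      total_cost N g' + (\<Sum>c\<in>constraints N. y c * residual N loc s c g' u')"
proof -
  let ?B = "binding_constraints N loc s g u"
  \<comment> \<open>The inequalities are all indices outside \<open>Some\<close> applied to
    \<open>range Balance\<close>, so balance multipliers may have either sign.\<close>
  have "\<exists>y. (\<forall>c\<in>Some ` ?B \<inter> - Some ` range Balance. 0 \<le> y c) \<and>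
      (\<forall>x\<in>direction_values N loc g. x None + (\<Sum>c\<in>Some ` ?B. y c * x c) = 0)"
  proof (rule lagrange_multipliers[OF _ linear_closed_direction_values])
    show "finite (Some ` ?B)"
      using finite_binding by blast
    show "\<exists>x\<in>direction_values N loc g. \<forall>c\<in>Some ` ?B. x c = r c" for r
      using licq_surjective[OF licq] .
    fix x
    assume "x \<in> direction_values N loc g" and le: "\<forall>c\<in>Some ` ?B. x c \<le> 0"
      and eq: "\<forall>c\<in>Some ` ?B - - Some ` range Balance. x c = 0"
    then obtain h v where x: "x = case_option (cost_gradient N g h) (\<lambda>c. gradient N loc c h v)"
      unfolding direction_values_def by blast
    show "0 \<le> x None"
      unfolding x option.case
    proof (rule solution_no_descent[OF net sol])
      show "gradient N loc c h v \<le> 0" if "c \<in> ?B" for c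
        using le that by (auto simp: x)
      show "gradient N loc (Balance t) h v = 0" if "Balance t \<in> ?B" for t
        using bspec[OF eq, of "Some (Balance t)"] that unfolding x by auto
    qed
  qed
  then obtain z where z_nonneg: "\<And>c. c \<in> ?B \<Longrightarrow> c \<notin> range Balance \<Longrightarrow> 0 \<le> z (Some c)"
    and "\<And>x. x \<in> direction_values N loc g \<Longrightarrow> x None + (\<Sum>c\<in>Some ` ?B. z c * x c) = 0"
    by blast
  then have stat: "cost_gradient N g h + (\<Sum>c\<in>?B. z (Some c) * gradient N loc c h v) = 0" for h v
  proof -
    let ?x = "case_option (cost_gradient N g h) (\<lambda>c. gradient N loc c h v)"
    have "?x \<in> direction_values N loc g"
      unfolding direction_values_def by blast
    then have "?x None + (\<Sum>c\<in>Some ` ?B. z c * ?x c) = 0"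
      by fact
    then show ?thesis
      by (subst (asm) sum.reindex) auto
  qed
  obtain Q where Q: "\<And>g h. total_cost N (\<lambda>t. g t + h t) = total_cost N g + cost_gradient N g h + Q h"
    "\<And>h. 0 \<le> Q h" "\<And>a h. Q (\<lambda>t. a *\<^sub>R h t) = a\<^sup>2 * Q h"
    by (rule total_cost_expansion[OF net]) (rule that)
  \<comment> \<open>Extension by zero to the nonbinding constraints builds complementary slackness
    in.\<close>
  define y where "y c = (if c \<in> ?B then z (Some c) else 0)" for c
  show thesis
  proof
    show "0 \<le> y c" if "c \<in> constraints N - range Balance" for c
      using that z_nonneg by (auto simp: y_def)
    fix g' u'
    let ?h = "\<lambda>t. g' t - g t" and ?v = "\<lambda>k t. u' k t - u k t"
    have "(\<Sum>c\<in>constraints N. y c * residual N loc s c g' u') =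
        (\<Sum>c\<in>?B. z (Some c) * residual N loc s c g' u')"
      by (rule sum.mono_neutral_cong_right) (auto simp: y_def binding_constraints_def)
    also have "\<dots> = (\<Sum>c\<in>?B. z (Some c) * gradient N loc c ?h ?v)"
      by (rule sum.cong)
        (auto simp: residual_diff[of N loc s _ g' u' g u] binding_constraints_def)
    \<comment> \<open>Binding residuals vanish at the solution, so they equal their gradients at the
      displacement; stationarity cancels the first-order cost, leaving \<open>Q\<close>.\<close>
    finally have "total_cost N g' + (\<Sum>c\<in>constraints N. y c * residual N loc s c g' u') =
        total_cost N g + Q ?h"
      using Q(1)[of g ?h] stat[of ?h ?v] by simp
    then show "total_cost N g \<le>
        total_cost N g' + (\<Sum>c\<in>constraints N. y c * residual N loc s c g' u')"
      using Q(2)[of ?h] by simp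
  qed
qed

text \<open>The KKT multipliers are dual feasible with dual value at least the optimal cost. A dual
  optimum does no worse, and its dual value is a lower bound of its Lagrangian everywhere.\<close>

lemma dual_optimal_saddle:
  assumes net: "network_data N" and sol: "mped_solution N loc s g u" and licq: "licq_at N loc s g u"
    and dual: "dual_optimal N loc s \<gamma> \<beta> \<nu> \<mu> \<omega> \<phi>"
  shows "total_cost N g \<le> lagrangian N loc s \<gamma> \<beta> \<nu> \<mu> \<omega> \<phi> g' u'"
proof -
  obtain y where y: "\<And>c. c \<in> constraints N - range Balance \<Longrightarrow> 0 \<le> y c"
    "\<And>g' u'. total_cost N g \<le>
      total_cost N g' + (\<Sum>c\<in>constraints N. y c * residual N loc s c g' u')"
    using kkt_multipliers_exist[OF net sol licq] by blast
  let ?\<gamma> = "\<lambda>t. - y (Balance t)" and ?\<beta> = "\<lambda>t. \<chi> l. y (Line t l)"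
    and ?\<nu> = "\<lambda>k t. y (Energy_Lower k t)" and ?\<mu> = "\<lambda>k t. y (Energy_Upper k t)"
    and ?\<omega> = "\<lambda>k t. y (Power_Lower k t)" and ?\<phi> = "\<lambda>k t. y (Power_Upper k t)"
  have mult: "multiplier ?\<gamma> ?\<beta> ?\<nu> ?\<mu> ?\<omega> ?\<phi> c = y c" for c
    by (cases c) auto
  have "dual_feasible N ?\<beta> ?\<nu> ?\<mu> ?\<omega> ?\<phi>"
    unfolding dual_feasible_def by (auto simp: less_eq_vec_def intro!: y(1))
  then have "dual_function N loc s ?\<gamma> ?\<beta> ?\<nu> ?\<mu> ?\<omega> ?\<phi> \<le> dual_function N loc s \<gamma> \<beta> \<nu> \<mu> \<omega> \<phi>"
    using dual unfolding dual_optimal_def by blast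
  moreover have "ereal (total_cost N g) \<le> dual_function N loc s ?\<gamma> ?\<beta> ?\<nu> ?\<mu> ?\<omega> ?\<phi>"
    unfolding dual_function_def lagrangian_eq mult by (rule INF_greatest) (use y(2) in auto)
  moreover have "dual_function N loc s \<gamma> \<beta> \<nu> \<mu> \<omega> \<phi> \<le> ereal (lagrangian N loc s \<gamma> \<beta> \<nu> \<mu> \<omega> \<phi> g' u')"
    unfolding dual_function_def by (rule INF_lower2[of "(g', u')"]) auto
  ultimately show ?thesis
    by (meson ereal_less_eq(3) order_trans)
qed

lemma multiplier_nonneg:
  assumes "dual_feasible N \<beta> \<nu> \<mu> \<omega> \<phi>" "c \<in> constraints N" "c \<notin> range Balance"
  shows "0 \<le> multiplier \<gamma> \<beta> \<nu> \<mu> \<omega> \<phi> c"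
  using assms unfolding dual_feasible_def by (cases c) (auto simp: less_eq_vec_def)

lemma multiplier_residual_nonpos:
  assumes "dual_feasible N \<beta> \<nu> \<mu> \<omega> \<phi>" "mped_feasible N loc s g u" "c \<in> constraints N"
  shows "multiplier \<gamma> \<beta> \<nu> \<mu> \<omega> \<phi> c * residual N loc s c g u \<le> 0"
proof (cases "c \<in> range Balance")
  case True
  then show ?thesis
    using assms unfolding mped_feasible_iff by auto
next
  case False
  then show ?thesis
    using assms multiplier_nonneg[OF assms(1,3) False] unfolding mped_feasible_iff
    by (simp add: mult_nonneg_nonpos)
qed

text \<open>At the solution itself the saddle inequality makes the sum of the products nonnegative,
  while feasibility makes every summand nonpositive.\<close>

lemma complementary_slackness:
  assumes "network_data N" and sol: "mped_solution N loc s g u" and "licq_at N loc s g u"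
    and dual: "dual_optimal N loc s \<gamma> \<beta> \<nu> \<mu> \<omega> \<phi>" and c: "c \<in> constraints N"
  shows "multiplier \<gamma> \<beta> \<nu> \<mu> \<omega> \<phi> c * residual N loc s c g u = 0"
proof -
  let ?f = "\<lambda>c. - (multiplier \<gamma> \<beta> \<nu> \<mu> \<omega> \<phi> c * residual N loc s c g u)"
  have nonneg: "0 \<le> ?f c" if "c \<in> constraints N" for c
    using multiplier_residual_nonpos that sol dual
    unfolding mped_solution_def dual_optimal_def by fastforce
  have "sum ?f (constraints N) \<le> 0"
    using dual_optimal_saddle[OF assms(1-4), of g u] unfolding lagrangian_eq by (simp add: sum_negf)
  then have "sum ?f (constraints N) = 0"
    using sum_nonneg[of "constraints N" ?f] nonneg by force
  then show ?thesis
    using c nonneg by (simp add: sum_nonneg_eq_0_iff del: neg_0_le_iff_le)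
qed

subsection \<open>Sensitivity of the optimal value\<close>

text \<open>The gap \<open>r - l\<close> has a local minimum at \<open>a\<close>, so the two
  derivatives agree. The difference quotient of \<open>f\<close> lies between those of
  \<open>l\<close> and \<open>r\<close>, which share their limit.\<close>

lemma has_real_derivative_squeeze:
  fixes f :: "real \<Rightarrow> real"
  assumes l: "(l has_real_derivative D) (at a)" and r: "(r has_real_derivative E) (at a)"
    and ev: "\<forall>\<^sub>F x in at a. l x \<le> f x \<and> f x \<le> r x"
    and eq: "l a = f a" "r a = f a"
  shows "(f has_real_derivative D) (at a)"
proof -
  have "((\<lambda>x. r x - l x) has_real_derivative E - D) (at a)"
    by (intro derivative_intros l r)
  moreover obtain d where d: "d > 0" "\<And>x. x \<noteq> a \<Longrightarrow> dist x a < d \<Longrightarrow> l x \<le> f x \<and> f x \<le> r x"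
    using ev unfolding eventually_at by auto
  have "\<forall>y. \<bar>a - y\<bar> < d \<longrightarrow> r a - l a \<le> r y - l y"
    using d(2) eq by (force simp: dist_real_def abs_minus_commute)
  ultimately have ED: "E = D"
    using DERIV_local_min d(1) by force
  define q where "q h x = (h x - h a) / (x - a)" for h :: "real \<Rightarrow> real" and x
  have ql: "((\<lambda>x. \<bar>q l x - D\<bar> + \<bar>q r x - D\<bar>) \<longlongrightarrow> 0) (at a)"
    using l r unfolding has_field_derivative_iff ED q_def
    by (intro tendsto_add_zero tendsto_rabs_zero LIM_zero)
  have "\<forall>\<^sub>F x in at a. norm (q f x - D) \<le> \<bar>q l x - D\<bar> + \<bar>q r x - D\<bar>"
    using ev eventually_neq_at_within[of a a UNIV]
  proof eventually_elim
    case (elim x)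
    \<comment> \<open>Division by \<open>x - a\<close> reverses the order of the bounds to the left
      of \<open>a\<close>.\<close>
    then have "(q l x \<le> q f x \<and> q f x \<le> q r x) \<or> (q r x \<le> q f x \<and> q f x \<le> q l x)"
      unfolding q_def using eq
      by (cases "x > a") (auto simp: divide_right_mono divide_right_mono_neg)
    then show ?case
      by auto
  qed
  from Lim_null_comparison[OF this ql] show ?thesis
    unfolding has_field_derivative_iff q_def by (rule LIM_zero_cancel)
qed

lemma sum_rhs_change:
  "(\<Sum>c\<in>constraints N. multiplier \<gamma> \<beta> \<nu> \<mu> \<omega> \<phi> c * rhs_change N loc k a b c) =
     a * (\<Sum>t=1..periods N. \<mu> k t)
       + b * (\<Sum>t=1..periods N. storage_time N loc k t * (\<omega> k t + \<phi> k t))"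
proof -
  let ?f = "\<lambda>c. multiplier \<gamma> \<beta> \<nu> \<mu> \<omega> \<phi> c * rhs_change N loc k a b c"
  have "(\<Sum>t=1..periods N. ?f (Energy_Lower k' t) + ?f (Energy_Upper k' t)
       + ?f (Power_Lower k' t) + ?f (Power_Upper k' t)) =
    (if k' = k then \<Sum>t=1..periods N. a * \<mu> k t
       + b * (storage_time N loc k t * (\<omega> k t + \<phi> k t)) else 0)" for k'
    by (auto simp: algebra_simps intro!: sum.cong)
  then show ?thesis
    unfolding sum_constraints by (simp add: sum.distrib sum_distrib_left del: multiplier.simps)
qed

text \<open>Weak duality for the perturbed problem, using the multipliers of the original one: a
  point feasible after the change violates an original inequality by at most
  \<open>rhs_change\<close>.\<close>

lemma perturbed_cost_lower_bound:
  assumes net: "network_data N" and sol: "mped_solution N loc s g u" and licq: "licq_at N loc s g u"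
    and dual: "dual_optimal N loc s \<gamma> \<beta> \<nu> \<mu> \<omega> \<phi>"
    and feas: "mped_feasible N loc (s(k := x)) g' u'"
  shows "total_cost N g - ((x - s k) * (\<Sum>t=1..periods N. \<mu> k t)
      + (power_rating N k x - power_rating N k (s k))
        * (\<Sum>t=1..periods N. storage_time N loc k t * (\<omega> k t + \<phi> k t))) \<le> total_cost N g'"
proof -
  let ?m = "multiplier \<gamma> \<beta> \<nu> \<mu> \<omega> \<phi>"
  let ?r = "rhs_change N loc k (x - s k) (power_rating N k x - power_rating N k (s k))"
  have "total_cost N g \<le> total_cost N g' + (\<Sum>c\<in>constraints N. ?m c * residual N loc s c g' u')"
    using dual_optimal_saddle[OF net sol licq dual, of g' u'] unfolding lagrangian_eq .
  also have "(\<Sum>c\<in>constraints N. ?m c * residual N loc s c g' u') \<le>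
      (\<Sum>c\<in>constraints N. ?m c * ?r c)"
  proof (rule sum_mono)
    fix c assume "c \<in> constraints N"
    then have "?m c * residual N loc (s(k := x)) c g' u' \<le> 0"
      using multiplier_residual_nonpos[OF _ feas] dual unfolding dual_optimal_def by blast
    then show "?m c * residual N loc s c g' u' \<le> ?m c * ?r c"
      unfolding residual_capacity_change by (simp add: algebra_simps)
  qed
  finally show ?thesis
    unfolding sum_rhs_change by simp
qed

text \<open>If a capacity vanished, a lower and an upper bound with opposite gradients would both bind.\<close>

lemma capacity_pos:
  fixes u :: "'k::finite \<Rightarrow> nat \<Rightarrow> real"
  assumes "mped_feasible N loc s g u" and "licq_at N loc s g u" and "t \<in> {1..periods N}"
  shows "0 < s k" and "0 < power_limit N loc s k t"
proof -
  obtain h v where grad: "\<And>c. c \<in> binding_constraints N loc s g u \<Longrightarrow> gradient N loc c h v = 1"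
    using licq_direction[OF assms(2), of "\<lambda>_. 1"] by blast
  have feas: "storage_feasible N loc s k (u k)"
    using assms(1) unfolding mped_feasible_def by blast
  show "0 < s k"
  proof (rule ccontr)
    assume "\<not> 0 < s k"
    then have "soc (u k) t = 0" "s k = 0"
      using feas assms(3) unfolding storage_feasible_def by fastforce+
    then have "Energy_Lower k t \<in> binding_constraints N loc s g u"
      "Energy_Upper k t \<in> binding_constraints N loc s g u"
      using assms(3) by (auto simp: binding_constraints_def)
    from this[THEN grad] show False
      by simp
  qed
  show "0 < power_limit N loc s k t"
  proof (rule ccontr)
    assume "\<not> 0 < power_limit N loc s k t"
    then have "u k t = 0" "power_limit N loc s k t = 0"
      using feas assms(3) unfolding storage_feasible_def by fastforce+
    then have "Power_Lower k t \<in> binding_constraints N loc s g u"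
      "Power_Upper k t \<in> binding_constraints N loc s g u"
      using assms(3) by (auto simp: binding_constraints_def)
    from this[THEN grad] show False
      by simp
  qed
qed

lemma strictly_convex_quadratic_has_derivative:
  assumes "strictly_convex_quadratic f"
  shows "(f has_real_derivative deriv f x) (at x)"
proof -
  obtain a b c where "\<forall>x. f x = a * x\<^sup>2 + b * x + c"
    using assms unfolding strictly_convex_quadratic_def by blast
  then have f: "f = (\<lambda>x. a * x\<^sup>2 + b * x + c)"
    by blast
  have "(f has_real_derivative 2 * a * x + b) (at x)"
    unfolding f by (auto intro!: derivative_eq_intros)
  then show ?thesis
    using DERIV_imp_deriv by metis
qed

lemma power_rating_has_derivative:
  assumes "network_data N" "0 < x"
  shows "(power_rating N k has_real_derivative deriv (power_rating N k) x) (at x)"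
proof -
  obtain D where "(power_rating N k has_vector_derivative D x) (at x)"
    using assms unfolding network_data_def C1_differentiable_on_def by blast
  then have "(power_rating N k has_real_derivative D x) (at x)"
    by (simp add: has_real_derivative_iff_has_vector_derivative)
  then show ?thesis
    using DERIV_imp_deriv by metis
qed

lemma optimal_value_has_derivative:
  fixes N :: "('n::finite, 'm::finite, 'k::finite) network"
  assumes net: "network_data N" and sol: "mped_solution N loc s g u" and licq: "licq_at N loc s g u"
    and dual: "dual_optimal N loc s \<gamma> \<beta> \<nu> \<mu> \<omega> \<phi>"
  shows "((\<lambda>x. optimal_value N loc (s(k := x))) has_real_derivative
    - ((\<Sum>t=1..periods N. \<mu> k t) + deriv (power_rating N k) (s k)
        * (\<Sum>t=1..periods N. storage_time N loc k t * (\<omega> k t + \<phi> k t)))) (at (s k))"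
proof -
  let ?M = "\<Sum>t=1..periods N. \<mu> k t"
  let ?P = "\<Sum>t=1..periods N. storage_time N loc k t * (\<omega> k t + \<phi> k t)"
  have feas: "mped_feasible N loc s g u"
    using sol unfolding mped_solution_def by blast
  have "1 \<in> {1..periods N}"
    using net unfolding network_data_def by simp
  \<comment> \<open>Differentiability of \<open>power_rating\<close> is assumed only at positive
    capacities; LICQ supplies the positivity.\<close>
  with capacity_pos(1)[OF feas licq] have pos: "0 < s k"
    by blast
  let ?d = "\<lambda>x. power_rating N k x - power_rating N k (s k)"
  note pr = power_rating_has_derivative[OF net pos, of k]
  define lower where "lower x = total_cost N g - ((x - s k) * ?M + ?d x * ?P)" for x
  \<comment> \<open>Directions \<open>(h, v)\<close> and \<open>(h', v')\<close> follow a unit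
    increase of the energy capacity and of the power rating, respectively, on all binding
    constraints at once.\<close>
  obtain h v where hv: "\<And>c. c \<in> binding_constraints N loc s g u \<Longrightarrow>
      gradient N loc c h v = rhs_change N loc k 1 0 c"
    using licq_direction[OF licq, of "rhs_change N loc k 1 0"] by blast
  obtain h' v' where hv': "\<And>c. c \<in> binding_constraints N loc s g u \<Longrightarrow>
      gradient N loc c h' v' = rhs_change N loc k 0 1 c"
    using licq_direction[OF licq, of "rhs_change N loc k 0 1"] by blast
  \<comment> \<open>The second direction is scaled by the true change \<open>?d x\<close> of the
    rating, not by its linearisation, so the binding constraints stay exactly binding.\<close>
  define G where "G x t = g t + ((x - s k) *\<^sub>R h t + ?d x *\<^sub>R h' t)" for x t
  define U where "U x j t = u j t + ((x - s k) * v j t + ?d x * v' j t)" for x j t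
  define upper where "upper x = total_cost N (G x)" for x
  have res: "residual N loc (s(k := x)) c (G x) (U x) = residual N loc s c g u
      + ((x - s k) * (gradient N loc c h v - rhs_change N loc k 1 0 c)
         + ?d x * (gradient N loc c h' v' - rhs_change N loc k 0 1 c))" for x c
    unfolding residual_capacity_change G_def U_def residual_add gradient_linear
    by (subst rhs_change_linear) (simp add: algebra_simps)
  have d_lim: "(?d \<longlongrightarrow> 0) (at (s k))"
    using DERIV_isCont[OF pr] unfolding isCont_def by (rule LIM_zero)
  have "\<forall>\<^sub>F x in at (s k). mped_feasible N loc (s(k := x)) (G x) (U x)"
  proof (rule eventually_feasible[OF feas])
    show "((\<lambda>x. residual N loc (s(k := x)) c (G x) (U x)) \<longlongrightarrow> residual N loc s c g u) (at (s k))" for c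
      unfolding res by (rule tendsto_eq_intros d_lim refl | simp)+
    show "\<forall>\<^sub>F x in at (s k). residual N loc (s(k := x)) c (G x) (U x) \<le> 0 \<and>
        (c \<in> range Balance \<longrightarrow> residual N loc (s(k := x)) c (G x) (U x) = 0)"
      if "c \<in> binding_constraints N loc s g u" for c
      unfolding res using that hv[OF that] hv'[OF that] by (simp add: binding_constraints_def)
  qed
  then have bounds: "\<forall>\<^sub>F x in at (s k). lower x \<le> optimal_value N loc (s(k := x)) \<and>
      optimal_value N loc (s(k := x)) \<le> upper x"
  proof eventually_elim
    case (elim x)
    let ?C = "{total_cost N g |g u. mped_feasible N loc (s(k := x)) g u}"
    have mem: "upper x \<in> ?C"
      using elim unfolding upper_def by blast
    have le: "lower x \<le> c" if "c \<in> ?C" for c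
      using that perturbed_cost_lower_bound[OF net sol licq dual] unfolding lower_def by blast
    have "lower x \<le> Inf ?C"
      using mem le by (intro cInf_greatest) blast+
    moreover have "Inf ?C \<le> upper x"
      using le by (intro cInf_lower[OF mem] bdd_belowI)
    ultimately show ?case
      unfolding optimal_value_def by blast
  qed
  have value_eq: "optimal_value N loc (s(k := s k)) = total_cost N g"
    unfolding optimal_value_def fun_upd_triv
    using sol by (intro cInf_eq_minimum) (auto simp: mped_solution_def)
  have lower: "(lower has_real_derivative - (?M + deriv (power_rating N k) (s k) * ?P)) (at (s k))"
    unfolding lower_def by (rule derivative_eq_intros pr refl | simp)+
  \<comment> \<open>Only the existence of this derivative matters: the squeeze forces it to equal
    that of \<open>lower\<close>.\<close>
  have upper: "(upper has_real_derivative (\<Sum>t=1..periods N. \<Sum>i\<in>UNIV.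
      deriv (gen_cost N i) (g t $ i) * (h t $ i + deriv (power_rating N k) (s k) * h' t $ i))) (at (s k))"
  proof -
    have "((\<lambda>x. gen_cost N i (G x t $ i)) has_real_derivative
      deriv (gen_cost N i) (g t $ i) * (h t $ i + deriv (power_rating N k) (s k) * h' t $ i)) (at (s k))" for i t
    proof (rule DERIV_chain2[where f = "gen_cost N i" and g = "\<lambda>x. G x t $ i"])
      show "(gen_cost N i has_real_derivative deriv (gen_cost N i) (g t $ i)) (at (G (s k) t $ i))"
        using net strictly_convex_quadratic_has_derivative unfolding network_data_def
        by (simp add: G_def)
      show "((\<lambda>x. G x t $ i) has_real_derivative h t $ i + deriv (power_rating N k) (s k) * h' t $ i) (at (s k))"
      proof -
        have "((\<lambda>x. g t $ i + ((x - s k) * h t $ i + ?d x * h' t $ i)) has_real_derivative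
            0 + ((1 - 0) * h t $ i + (deriv (power_rating N k) (s k) - 0) * h' t $ i)) (at (s k))"
          by (intro DERIV_add DERIV_diff DERIV_cmult_right DERIV_const DERIV_ident pr)
        then show ?thesis
          by (simp add: G_def)
      qed
    qed
    then show ?thesis
      unfolding upper_def total_cost_def by (intro DERIV_sum)
  qed
  show ?thesis
  proof (rule has_real_derivative_squeeze[OF lower upper bounds])
    show "lower (s k) = optimal_value N loc (s(k := s k))"
      unfolding value_eq lower_def by simp
    show "upper (s k) = optimal_value N loc (s(k := s k))"
      unfolding value_eq upper_def G_def by simp
  qed
qed

subsection \<open>Prices and storage multipliers\<close>

text \<open>The slope of the Lagrangian when only unit \<open>k\<close> changes its operation, by
  \<open>w\<close>. Charging withdraws power at one bus, so the balance and line multipliers combine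
  to the price there.\<close>

lemma sum_multiplier_gradient_unit:
  fixes N :: "('n::finite, 'm::finite, 'k::finite) network"
  shows "(\<Sum>c\<in>constraints N. multiplier \<gamma> \<beta> \<nu> \<mu> \<omega> \<phi> c *
      gradient N loc c (\<lambda>_. 0) (\<lambda>j t. if j = k then w t else 0)) =
    (\<Sum>t=1..periods N. lmp N \<gamma> \<beta> t $ loc k t * w t
      + (\<mu> k t - \<nu> k t) * soc w t + (\<phi> k t - \<omega> k t) * w t)"
proof -
  let ?v = "\<lambda>j t. if j = k then w t else 0"
  let ?f = "\<lambda>c. multiplier \<gamma> \<beta> \<nu> \<mu> \<omega> \<phi> c * gradient N loc c (\<lambda>_. 0) ?v"
  have inj: "net_injection loc (\<lambda>_. 0) ?v t = - w t *\<^sub>R axis (loc k t) 1" for t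
  proof -
    have "(\<Sum>j\<in>UNIV. ?v j t *\<^sub>R axis (loc j t) (1::real)) =
        (\<Sum>j\<in>UNIV. if j = k then w t *\<^sub>R axis (loc k t) 1 else 0)"
      by (intro sum.cong) auto
    then show ?thesis
      by (simp add: net_injection_def)
  qed
  have prices: "?f (Balance t) + (\<Sum>l\<in>UNIV. ?f (Line t l)) = lmp N \<gamma> \<beta> t $ loc k t * w t"
    if "t \<in> {1..periods N}" for t
  proof -
    have balance: "?f (Balance t) = \<gamma> t * w t"
      by (simp add: inj inner_axis)
    have line: "?f (Line t l) = - (shift_factor N $ l $ loc k t * \<beta> t $ l) * w t" for l
      by (simp add: inj matrix_vector_mult_scaleR[of _ "- w t", simplified] matrix_vector_mult_basis column_def)
    have price: "lmp N \<gamma> \<beta> t $ loc k t =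
        \<gamma> t - (\<Sum>l\<in>UNIV. shift_factor N $ l $ loc k t * \<beta> t $ l)"
      using that by (simp add: lmp_def matrix_vector_mult_def transpose_def)
    show ?thesis
      unfolding balance line price
      by (simp add: left_diff_distrib sum_negf sum_distrib_right)
  qed
  have "(\<Sum>t=1..periods N. ?f (Energy_Lower j t) + ?f (Energy_Upper j t)
       + ?f (Power_Lower j t) + ?f (Power_Upper j t)) =
    (if j = k then \<Sum>t=1..periods N. (\<mu> k t - \<nu> k t) * soc w t + (\<phi> k t - \<omega> k t) * w t else 0)" for j
    by (auto simp: algebra_simps soc_def intro!: sum.cong)
  then have "(\<Sum>j\<in>UNIV. \<Sum>t=1..periods N. ?f (Energy_Lower j t) + ?f (Energy_Upper j t)
       + ?f (Power_Lower j t) + ?f (Power_Upper j t)) =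
    (\<Sum>t=1..periods N. (\<mu> k t - \<nu> k t) * soc w t + (\<phi> k t - \<omega> k t) * w t)"
    by (simp del: multiplier.simps gradient.simps)
  moreover have "(\<Sum>t=1..periods N. ?f (Balance t) + (\<Sum>l\<in>UNIV. ?f (Line t l))) =
      (\<Sum>t=1..periods N. lmp N \<gamma> \<beta> t $ loc k t * w t)"
    by (intro sum.cong refl prices)
  ultimately show ?thesis
    unfolding sum_constraints by (simp add: sum.distrib del: multiplier.simps gradient.simps)
qed

lemma real_slope_eq_0:
  assumes "\<And>e::real. 0 \<le> e * x"
  shows "x = 0"
  using assms[of 1] assms[of "- 1"] by simp

text \<open>Along a change of one unit's operation the Lagrangian is affine. By slackness it equals
  the optimal cost at the solution, and by the saddle property it never falls below it; a slope of
  either sign would contradict this.\<close>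

lemma storage_stationary:
  assumes net: "network_data N" and sol: "mped_solution N loc s g u" and licq: "licq_at N loc s g u"
    and dual: "dual_optimal N loc s \<gamma> \<beta> \<nu> \<mu> \<omega> \<phi>"
  shows "(\<Sum>t=1..periods N. lmp N \<gamma> \<beta> t $ loc k t * w t
      + (\<mu> k t - \<nu> k t) * soc w t + (\<phi> k t - \<omega> k t) * w t) = 0"
proof (rule real_slope_eq_0)
  fix e :: real
  let ?m = "multiplier \<gamma> \<beta> \<nu> \<mu> \<omega> \<phi>" and ?v = "\<lambda>j t. if j = k then w t else 0"
  \<comment> \<open>The zero displacement is written out so that \<open>residual_add\<close> and
    \<open>gradient_scale\<close> match.\<close>
  let ?g = "\<lambda>t. g t + e *\<^sub>R 0" and ?u = "\<lambda>j t. u j t + e * ?v j t"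
  have "total_cost N g \<le> total_cost N ?g + (\<Sum>c\<in>constraints N. ?m c * residual N loc s c ?g ?u)"
    using dual_optimal_saddle[OF net sol licq dual, of ?g ?u] unfolding lagrangian_eq .
  also have "(\<Sum>c\<in>constraints N. ?m c * residual N loc s c ?g ?u) =
      (\<Sum>c\<in>constraints N. e * (?m c * gradient N loc c (\<lambda>_. 0) ?v))"
    unfolding residual_add gradient_scale
    by (intro sum.cong) (simp_all add: distrib_left complementary_slackness[OF net sol licq dual])
  finally show "0 \<le> e * (\<Sum>t=1..periods N. lmp N \<gamma> \<beta> t $ loc k t * w t
      + (\<mu> k t - \<nu> k t) * soc w t + (\<phi> k t - \<omega> k t) * w t)"
    unfolding sum_distrib_left[symmetric] sum_multiplier_gradient_unit by simp
qed

lemma price_equation: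
  assumes net: "network_data N" and sol: "mped_solution N loc s g u" and licq: "licq_at N loc s g u"
    and dual: "dual_optimal N loc s \<gamma> \<beta> \<nu> \<mu> \<omega> \<phi>" and t: "t \<in> {1..periods N}"
  shows "lmp N \<gamma> \<beta> t $ loc k t = \<omega> k t - \<phi> k t - (\<Sum>\<tau>=t..periods N. \<mu> k \<tau> - \<nu> k \<tau>)"
proof -
  \<comment> \<open>Charging one unit of energy at \<open>t\<close> raises the state of charge from
    \<open>t\<close> onwards, so stationarity collects all later energy multipliers.\<close>
  define w :: "nat \<Rightarrow> real" where "w \<tau> = (if \<tau> = t then 1 else 0)" for \<tau>
  have soc: "soc w \<tau> = (if t \<le> \<tau> then 1 else 0)" for \<tau>
    using t by (simp add: soc_def w_def)
  have "(\<Sum>\<tau>=1..periods N. (\<mu> k \<tau> - \<nu> k \<tau>) * soc w \<tau>) = (\<Sum>\<tau>=t..periods N. \<mu> k \<tau> - \<nu> k \<tau>)"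
    by (rule sum.mono_neutral_cong_right) (use t in \<open>auto simp: soc\<close>)
  moreover have "(\<Sum>\<tau>=1..periods N. p \<tau> * w \<tau>) = p t" for p
    using t by (simp add: w_def if_distrib cong: if_cong)
  ultimately show ?thesis
    using storage_stationary[OF net sol licq dual, of k w] by (simp add: sum.distrib)
qed

lemma slackness_unit:
  assumes "network_data N" "mped_solution N loc s g u" "licq_at N loc s g u"
    and "dual_optimal N loc s \<gamma> \<beta> \<nu> \<mu> \<omega> \<phi>" and "t \<in> {1..periods N}"
  shows "\<nu> k t * soc (u k) t = 0" "\<mu> k t * (soc (u k) t - s k) = 0"
    "\<omega> k t * (u k t + power_limit N loc s k t) = 0" "\<phi> k t * (u k t - power_limit N loc s k t) = 0"
proof -
  note slack = complementary_slackness[OF assms(1-4)]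
  show "\<nu> k t * soc (u k) t = 0"
    using slack[of "Energy_Lower k t"] assms(5) by simp
  show "\<mu> k t * (soc (u k) t - s k) = 0"
    using slack[of "Energy_Upper k t"] assms(5) by simp
  show "\<omega> k t * (u k t + power_limit N loc s k t) = 0"
    using slack[of "Power_Lower k t"] assms(5) by (auto simp: algebra_simps)
  show "\<phi> k t * (u k t - power_limit N loc s k t) = 0"
    using slack[of "Power_Upper k t"] assms(5) by simp
qed

text \<open>This links \<open>u k\<close> to the unique arbitrage solution. Stationarity trades the
  price difference between two operations for multiplier terms, whose sign follows from slackness at
  \<open>u k\<close> and feasibility of the competitor.\<close>

lemma solution_arbitrage:
  assumes net: "network_data N" and sol: "mped_solution N loc s g u" and licq: "licq_at N loc s g u"
    and dual: "dual_optimal N loc s \<gamma> \<beta> \<nu> \<mu> \<omega> \<phi>"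
  shows "arbitrage_solution N loc s (lmp N \<gamma> \<beta>) k (u k)"
  unfolding arbitrage_solution_def
proof (intro conjI allI impI)
  show "storage_feasible N loc s k (u k)"
    using sol unfolding mped_solution_def mped_feasible_def by blast
  fix v assume v: "storage_feasible N loc s k v"
  let ?p = "\<lambda>t. lmp N \<gamma> \<beta> t $ loc k t" and ?w = "\<lambda>t. 1 * v t + (- 1) * u k t"
  have "(\<Sum>t=1..periods N. (\<mu> k t - \<nu> k t) * soc ?w t + (\<phi> k t - \<omega> k t) * ?w t) \<le> 0"
  proof (rule sum_nonpos)
    fix t assume t: "t \<in> {1..periods N}"
    note slack = slackness_unit[OF net sol licq dual t, of k]
    have "0 \<le> \<nu> k t" "0 \<le> \<mu> k t" "0 \<le> \<omega> k t" "0 \<le> \<phi> k t"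
      using dual t unfolding dual_optimal_def dual_feasible_def by blast+
    moreover have "0 \<le> soc v t" "soc v t \<le> s k"
      "0 \<le> v t + power_limit N loc s k t" "v t \<le> power_limit N loc s k t"
      using v t unfolding storage_feasible_def by fastforce+
    ultimately have "0 \<le> \<nu> k t * soc v t" "\<mu> k t * soc v t \<le> \<mu> k t * s k"
      "0 \<le> \<omega> k t * (v t + power_limit N loc s k t)" "\<phi> k t * v t \<le> \<phi> k t * power_limit N loc s k t"
      by (auto intro: mult_left_mono)
    then show "(\<mu> k t - \<nu> k t) * soc ?w t + (\<phi> k t - \<omega> k t) * ?w t \<le> 0"
      using slack unfolding soc_linear by (simp only: algebra_simps)
  qed
  then have "0 \<le> (\<Sum>t=1..periods N. ?p t * ?w t)"
    using storage_stationary[OF net sol licq dual, of k ?w] by (simp add: sum.distrib)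
  then show "arbitrage_profit N loc (lmp N \<gamma> \<beta>) k v \<le> arbitrage_profit N loc (lmp N \<gamma> \<beta>) k (u k)"
    by (simp add: arbitrage_profit_def algebra_simps sum_subtractf)
qed

text \<open>A period in both sets would admit a direction that changes the state of charge there although it
  stops all changes at every other time in \<open>Te\<close> and all operation in \<open>Tp\<close>: starting from an empty
  unit, no change of the state of charge can then ever build up.\<close>

lemma energy_power_times_disjoint:
  assumes licq: "licq_at N loc s g u"
    and cover: "energy_times N s k (u k) \<union> power_times N loc s k (u k) = {1..periods N}"
  shows "energy_times N s k (u k) \<inter> power_times N loc s k (u k) = {}"
proof (rule ccontr)
  let ?B = "binding_constraints N loc s g u"
  let ?Te = "energy_times N s k (u k)" and ?Tp = "power_times N loc s k (u k)"
  assume "?Te \<inter> ?Tp \<noteq> {}"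
  then obtain t0 where t0: "t0 \<in> ?Te" "t0 \<in> ?Tp"
    by blast
  \<comment> \<open>Whichever energy bound binds at \<open>t0\<close>, the value 1 forces a nonzero
    change of the state of charge there.\<close>
  obtain h v where grad: "\<And>c. c \<in> ?B \<Longrightarrow>
      gradient N loc c h v = (if c \<in> {Energy_Lower k t0, Energy_Upper k t0} then 1 else 0)"
    using licq_direction[OF licq, of "\<lambda>c. if c \<in> {Energy_Lower k t0, Energy_Upper k t0} then 1 else 0"]
    by blast
  have bind_e: "Energy_Lower k t \<in> ?B \<or> Energy_Upper k t \<in> ?B" if "t \<in> ?Te" for t
    using that by (auto simp: energy_times_def binding_constraints_def)
  have bind_p: "Power_Lower k t \<in> ?B \<or> Power_Upper k t \<in> ?B" if "t \<in> ?Tp" for t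
    using that by (auto simp: power_times_def binding_constraints_def)
  have e0: "soc (v k) t = 0" if "t \<in> ?Te" "t \<noteq> t0" for t
    using bind_e[OF that(1)] grad[of "Energy_Lower k t"] grad[of "Energy_Upper k t"] that(2) by auto
  have p0: "v k t = 0" if "t \<in> ?Tp" for t
    using bind_p[OF that] grad[of "Power_Lower k t"] grad[of "Power_Upper k t"] by auto
  have "soc (v k) t0 \<noteq> 0"
    using bind_e[OF t0(1)] grad[of "Energy_Lower k t0"] grad[of "Energy_Upper k t0"] by auto
  moreover have "soc (v k) t = 0" if "t \<le> t0" for t
    using that
  proof (induction t)
    \<comment> \<open>The empty sum: every unit starts empty.\<close>
    case 0
    then show ?case
      by (simp add: soc_def)
  next
    case (Suc t)
    have "Suc t \<in> {1..periods N}"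
      using Suc.prems t0(1) by (auto simp: energy_times_def)
    then have "Suc t \<in> ?Te \<union> ?Tp"
      using cover by blast
    then consider "Suc t \<in> ?Te" "Suc t \<noteq> t0" | "Suc t \<in> ?Tp"
      using t0(2) by blast
    then show ?case
    proof cases
      case 1
      then show ?thesis
        by (rule e0)
    next
      case 2
      then have "v k (Suc t) = 0"
        by (rule p0)
      moreover have "soc (v k) t = 0"
        using Suc by simp
      ultimately show ?thesis
        by (simp add: soc_def)
    qed
  qed
  ultimately show False
    by blast
qed

lemma next_energy_time:
  assumes "Te \<subseteq> {1..T}" "t \<in> {1..T}"
  shows "next_energy_time T Te t \<in> insert (T + 1) Te" "t < next_energy_time T Te t"
    "\<And>\<tau>. t < \<tau> \<Longrightarrow> \<tau> < next_energy_time T Te t \<Longrightarrow> \<tau> \<notin> Te"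
proof -
  let ?A = "{\<tau> \<in> insert (T + 1) Te. t < \<tau>}"
  \<comment> \<open>The added \<open>T + 1\<close> guarantees a later element, so the infimum is
    attained.\<close>
  have "?A \<noteq> {}"
    using assms(2) by auto
  from Inf_nat_def1[OF this]
  show "next_energy_time T Te t \<in> insert (T + 1) Te" "t < next_energy_time T Te t"
    unfolding next_energy_time_def by blast+
  show "\<tau> \<notin> Te" if "t < \<tau>" "\<tau> < next_energy_time T Te t" for \<tau>
  proof
    assume "\<tau> \<in> Te"
    then have "next_energy_time T Te t \<le> \<tau>"
      unfolding next_energy_time_def using that(1) by (intro cInf_lower) auto
    then show False
      using that(2) by simp
  qed
qed

text \<open>Between \<open>t\<close> and \<open>\<sigma> t\<close> no energy multiplier is active,
  and at \<open>\<sigma> t\<close> no power multiplier is. The price difference therefore involves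
  only multipliers at \<open>t\<close>: energy ones on \<open>Te\<close>, power ones on
  \<open>Tp\<close>. Opposite bounds cannot both be active, which yields the positive part and the
  absolute value.\<close>

lemma multipliers_from_prices:
  fixes N :: "('n::finite, 'm::finite, 'k::finite) network" and k :: 'k
  assumes net: "network_data N" and sol: "mped_solution N loc s g u" and licq: "licq_at N loc s g u"
    and dual: "dual_optimal N loc s \<gamma> \<beta> \<nu> \<mu> \<omega> \<phi>"
  defines "Te \<equiv> energy_times N s k (u k)" and "Tp \<equiv> power_times N loc s k (u k)"
    and "price \<equiv> \<lambda>t. lmp N \<gamma> \<beta> t $ loc k t"
  defines "\<sigma> \<equiv> next_energy_time (periods N) Te"
  assumes cover: "Te \<union> Tp = {1..periods N}"
  shows "t \<in> Te \<Longrightarrow> \<mu> k t = max 0 (price (\<sigma> t) - price t) \<and> \<omega> k t + \<phi> k t = 0"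
    and "t \<in> Tp \<Longrightarrow> \<mu> k t = 0 \<and> \<omega> k t + \<phi> k t = \<bar>price (\<sigma> t) - price t\<bar>"
proof -
  let ?T = "periods N"
  define M where "M t = (\<Sum>\<tau>=t..?T. \<mu> k \<tau> - \<nu> k \<tau>)" for t
  have disj: "Te \<inter> Tp = {}"
    using energy_power_times_disjoint[OF licq] cover unfolding Te_def Tp_def by blast
  have feas: "mped_feasible N loc s g u"
    using sol unfolding mped_solution_def by blast
  have nonneg: "0 \<le> \<nu> k t" "0 \<le> \<mu> k t" "0 \<le> \<omega> k t" "0 \<le> \<phi> k t" if "t \<in> {1..?T}" for t
    using dual that unfolding dual_optimal_def dual_feasible_def by blast+
  note slack = slackness_unit[OF net sol licq dual, of _ k]
  have not_e: "\<mu> k t = 0 \<and> \<nu> k t = 0" if "t \<in> {1..?T}" "t \<notin> Te" for t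
    using slack(1,2)[OF that(1)] that by (auto simp: Te_def energy_times_def)
  have not_p: "\<omega> k t = 0 \<and> \<phi> k t = 0" if "t \<in> Te" for t
  proof -
    have "t \<in> {1..?T}" "t \<notin> Tp"
      using that disj cover by blast+
    then show ?thesis
      using slack(3,4)[of t] by (auto simp: Tp_def power_times_def add_eq_0_iff)
  qed
  have price_eq: "price t = \<omega> k t - \<phi> k t - M t" if "t \<in> {1..?T}" for t
    using price_equation[OF net sol licq dual that] unfolding price_def M_def by blast
  have step: "price (\<sigma> t) - price t = (\<mu> k t - \<nu> k t) - (\<omega> k t - \<phi> k t)" if t: "t \<in> {1..?T}" for t
  proof -
    have sub: "Te \<subseteq> {1..?T}"
      using cover by blast
    note \<sigma> = next_energy_time[OF sub t, folded \<sigma>_def]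
    have le: "\<sigma> t \<le> ?T + 1"
      using \<sigma>(1) sub by fastforce
    \<comment> \<open>At an energy time the power multipliers vanish; at \<open>?T + 1\<close> the
      price is zero by definition of \<open>lmp\<close> and the sum \<open>M\<close> is
      empty.\<close>
    have "price (\<sigma> t) = - M (\<sigma> t)"
    proof (cases "\<sigma> t \<in> Te")
      case True
      then show ?thesis
        using price_eq[of "\<sigma> t"] not_p[of "\<sigma> t"] sub by auto
    next
      case False
      then have "\<sigma> t = ?T + 1"
        using \<sigma>(1) by blast
      then show ?thesis
        by (simp add: price_def M_def lmp_def)
    qed
    moreover have "M t = (\<mu> k t - \<nu> k t) + M (\<sigma> t)"
    proof -
      have "{t..?T} = {t} \<union> {t<..<\<sigma> t} \<union> {\<sigma> t..?T}"
        using t \<sigma>(2) le by auto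
      then have "M t = (\<Sum>\<tau>\<in>{t} \<union> {t<..<\<sigma> t}. \<mu> k \<tau> - \<nu> k \<tau>) + M (\<sigma> t)"
        unfolding M_def using \<sigma>(2) by (simp only:) (rule sum.union_disjoint, auto)
      also have "(\<Sum>\<tau>\<in>{t} \<union> {t<..<\<sigma> t}. \<mu> k \<tau> - \<nu> k \<tau>) = (\<Sum>\<tau>\<in>{t}. \<mu> k \<tau> - \<nu> k \<tau>)"
      proof (rule sum.mono_neutral_right)
        show "\<forall>\<tau>\<in>{t} \<union> {t<..<\<sigma> t} - {t}. \<mu> k \<tau> - \<nu> k \<tau> = 0"
          using not_e \<sigma>(3) t le by auto
      qed auto
      finally show ?thesis
        by simp
    qed
    ultimately show ?thesis
      using price_eq[OF t] by simp
  qed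
  show "\<mu> k t = max 0 (price (\<sigma> t) - price t) \<and> \<omega> k t + \<phi> k t = 0" if "t \<in> Te"
  proof -
    have t: "t \<in> {1..?T}"
      using that cover by blast
    \<comment> \<open>Otherwise the state of charge would equal both 0 and the positive
      capacity.\<close>
    have "\<mu> k t = 0 \<or> \<nu> k t = 0"
      using slack(1,2)[OF t] capacity_pos(1)[OF feas licq t, of k] by auto
    then show ?thesis
      using step[OF t] not_p[OF that] nonneg[OF t] by auto
  qed
  show "\<mu> k t = 0 \<and> \<omega> k t + \<phi> k t = \<bar>price (\<sigma> t) - price t\<bar>" if "t \<in> Tp"
  proof -
    have t: "t \<in> {1..?T}" and "t \<notin> Te"
      using that disj cover by blast+
    \<comment> \<open>Otherwise the operation would equal both the positive power limit and its
      negative.\<close>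
    moreover have "\<omega> k t = 0 \<or> \<phi> k t = 0"
      using slack(3,4)[OF t] capacity_pos(2)[OF feas licq t, of k] by auto
    ultimately show ?thesis
      using step[OF t] not_e[OF t] nonneg[OF t] by auto
  qed
qed

theorem theorem2:
  fixes N :: "('n::finite, 'm::finite, 'k::finite) network"
    and loc :: "('n, 'k) relocation"
    and s :: "'k \<Rightarrow> real"
    and k :: 'k
    and g :: "nat \<Rightarrow> real ^ 'n" and u :: "'k \<Rightarrow> nat \<Rightarrow> real"
    and \<gamma> :: "nat \<Rightarrow> real" and \<beta> :: "nat \<Rightarrow> real ^ ('m + 'm)"
    and \<nu> \<mu> \<omega> \<phi> :: "'k \<Rightarrow> nat \<Rightarrow> real"
    and uk :: "nat \<Rightarrow> real"
  assumes "network_data N"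
    and "mped_solution N loc s g u"
    and "licq_at N loc s g u"
    and "dual_optimal N loc s \<gamma> \<beta> \<nu> \<mu> \<omega> \<phi>"
    and "unique_arbitrage_solution N loc s (lmp N \<gamma> \<beta>) k uk"
  shows "(\<lambda>x. optimal_value N loc (s(k := x))) differentiable at (s k) \<and>
    marginal_value N loc s k =
      (\<Sum>t=1..periods N. \<mu> k t)
      + deriv (power_rating N k) (s k)
        * (\<Sum>t=1..periods N. storage_time N loc k t * (\<omega> k t + \<phi> k t)) \<and>
    (let T = periods N;
         Te = energy_times N s k uk;
         Tp = power_times N loc s k uk;
         \<sigma> = next_energy_time T Te;
         price = (\<lambda>t. lmp N \<gamma> \<beta> t $ loc k t)
     in Te \<union> Tp = {1..T} \<longrightarrow>
          Te \<inter> Tp = {} \<and>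
          (\<forall>t\<in>Te. \<mu> k t = max 0 (price (\<sigma> t) - price t) \<and> \<omega> k t + \<phi> k t = 0) \<and>
          (\<forall>t\<in>Tp. \<mu> k t = 0 \<and> \<omega> k t + \<phi> k t = \<bar>price (\<sigma> t) - price t\<bar>))"
proof -
  note D = optimal_value_has_derivative[OF assms(1-4), of k]
  have diff: "(\<lambda>x. optimal_value N loc (s(k := x))) differentiable at (s k)"
    using D real_differentiable_def by blast
  have marginal: "marginal_value N loc s k = (\<Sum>t=1..periods N. \<mu> k t)
      + deriv (power_rating N k) (s k)
        * (\<Sum>t=1..periods N. storage_time N loc k t * (\<omega> k t + \<phi> k t))"
    unfolding marginal_value_def DERIV_imp_deriv[OF D] by simp
  \<comment> \<open>By uniqueness the two operations agree on the horizon, hence the binding times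
    read off from either coincide.\<close>
  have uk: "u k t = uk t" if "t \<in> {1..periods N}" for t
    using assms(5) solution_arbitrage[OF assms(1-4)] that
    unfolding unique_arbitrage_solution_def by blast
  have soc: "soc (u k) t = soc uk t" if "t \<in> {1..periods N}" for t
    unfolding soc_def using that uk by (intro sum.cong) auto
  have times: "energy_times N s k uk = energy_times N s k (u k)"
    "power_times N loc s k uk = power_times N loc s k (u k)"
    unfolding energy_times_def power_times_def using uk soc by auto
  show ?thesis
    unfolding Let_def times
    by (intro conjI impI diff marginal;
        (erule energy_power_times_disjoint[OF assms(3)]
          | (rule ballI, erule multipliers_from_prices[OF assms(1-4)], assumption)))
qed

end
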